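(* Consider the primal problem (P): $\min_{s\in\mathbb{R}^n,\beta\in\mathbb{R}^p}\{L(s)+\lambda\Psi(\beta): X\beta-s-y=0\}$ and its dual (D): $\min_{w\in\mathbb{R}^n}\{\langle y,w\rangle+L^*(w)+\lambda\Psi^*(-\lambda^{-1}X^\top w)\}$. Run the following inexact proximal augmented Lagrangian method without termination: given $(w^0,s^0,\beta^0)$, $\sigma_0>0$, $\tau>0$ and a summable sequence $\{\delta_k\}$ of positive numbers with $\delta_k<1$, for $k=0,1,2,\dots$: compute $w^{k+1}$ as an approximate minimizer of $\psi_k(w)=\mathcal{L}_{\sigma_k}(w;s^k,\beta^k)+\frac{\tau}{2\sigma_k}\|w-w^k\|_2^2$; set $s^{k+1}=\sigma_k\operatorname{Prox}_L(s^k/\sigma_k+w^{k+1})$ and $\beta^{k+1}=\sigma_k\lambda\operatorname{Prox}_\Psi(\beta^k/(\sigma_k\lambda)-X^\top w^{k+1}/\lambda)$, where $w^{k+1}$ is required to satisfy $$\|\nabla\psi_k(w^{k+1})\|_2\le\frac{\delta_k\min(1,\sqrt\tau)}{\sigma_k}\min\{1,\|(\sqrt\tau w^{k+1},s^{k+1},\beta^{k+1})-(\sqrt\tau w^k,s^k,\beta^k)\|_2\};$$ then choose $\sigma_{k+1}\ge\sigma_k$. Then $\{(s^k,\beta^k)\}$ converges to an optimal solution of (P) and $\{w^k\}$ converges to an optimal solution of (D). Moreover, let $r>\sum_{k=0}^\infty\delta_k$ and let $\kappa>0$ be such that $\operatorname{dist}(z,\mathcal{T}^{-1}(0))\le\kappa\operatorname{dist}(0,\mathcal{T}(z))$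 for all $z=(w,s,\beta)$ with $\operatorname{dist}(z,\mathcal{T}^{-1}(0))\le r$. If $\operatorname{dist}((w^0,s^0,\beta^0),\mathcal{T}^{-1}(0))\le r-\sum_{k=0}^\infty\delta_k$, then for all $k$, $$\operatorname{dist}_{\mathcal{M}}\big((w^{k+1},s^{k+1},\beta^{k+1}),\mathcal{T}^{-1}(0)\big)\le\mu_k\operatorname{dist}_{\mathcal{M}}\big((w^k,s^k,\beta^k),\mathcal{T}^{-1}(0)\big),$$ where $\mu_k=(1-\delta_k)^{-1}\big(\delta_k+(1+\delta_k)\kappa\gamma/\sqrt{\sigma_k^2+\kappa^2\gamma^2}\big)$ and $\gamma=\max\{1,\tau\}$.
   Context: $X\in\mathbb{R}^{n\times p}$, $y\in\mathbb{R}^n$, $\lambda>0$. $L(s)=\frac{1}{n(n-1)}\sum_{i=1}^n\sum_{j\neq i}|s_i-s_j|$; $[p]$ is partitioned into nonempty disjoint groups $\mathcal{G}_1,\dots,\mathcal{G}_g$ with weights $w_l>0$ and $\Psi(\beta)=\sum_lw_l\|\beta_{\mathcal{G}_l}\|_2$. $f^*$ denotes the convex conjugate of $f$. For proper closed convex $f$ and $\sigma>0$, $e_\sigma f(x)=\min_u\{f(u)+\frac{1}{2\sigma}\|u-x\|_2^2\}$ is the Moreau envelope and $\operatorname{Prox}_{\sigma f}(x)$ its unique minimizer. The augmented Lagrangian is $\mathcal{L}_\sigma(w;s,\beta)=\langle y,w\rangle-e_\sigma L(s+\sigma w)+\frac{1}{2\sigma}\|s+\sigma w\|_2^2-\frac{1}{2\sigma}\|s\|_2^2-\lambda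 e_{\sigma\lambda}\Psi(\beta-\sigma X^\top w)+\frac{1}{2\sigma}\|\beta-\sigma X^\top w\|_2^2-\frac{1}{2\sigma}\|\beta\|_2^2$ (continuously differentiable in $w$). The maximal monotone operator $\mathcal{T}$ on $\mathbb{R}^n\times\mathbb{R}^n\times\mathbb{R}^p$ is $\mathcal{T}(w,s,\beta)=\{(w',s',\beta'): w'=y+s-X\beta,\ s'\in -w+\partial L(s),\ \beta'\in X^\top w+\partial(\lambda\Psi)(\beta)\}$, so $\mathcal{T}^{-1}(0)$ is the set of KKT points of (P)–(D). $\mathcal{M}=\operatorname{Diag}(\tau I_n,I_n,I_p)$, $\|x\|_{\mathcal{M}}=\sqrt{x^\top\mathcal{M}x}$, $\operatorname{dist}_{\mathcal{M}}(x,C)=\inf_{z\in C}\|x-z\|_{\mathcal{M}}$, and $\operatorname{dist}$ is the Euclidean distance. *)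

theory Defs
  imports "HOL-Analysis.Analysis"
begin

definition Lfun :: "real^'n \<Rightarrow> real" where
  "Lfun s = (1 / (real CARD('n) * (real CARD('n) - 1))) *
     (\<Sum>i\<in>UNIV. \<Sum>j\<in>UNIV - {i}. \<bar>s$i - s$j\<bar>)"

definition Psi :: "('g::finite \<Rightarrow> 'p set) \<Rightarrow> ('g \<Rightarrow> real) \<Rightarrow> real^'p \<Rightarrow> real" where
  "Psi G wt \<beta> = (\<Sum>l\<in>UNIV. wt l * sqrt (\<Sum>i\<in>G l. (\<beta>$i)^2))"

definition conjugate :: "('a::real_inner \<Rightarrow> real) \<Rightarrow> 'a \<Rightarrow> ereal" where
  "conjugate f x = (SUP u. ereal (x \<bullet> u - f u))"

definition moreau :: "real \<Rightarrow> ('a::real_normed_vector \<Rightarrow> real) \<Rightarrow> 'a \<Rightarrow> real" where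
  "moreau \<sigma> f x = Inf (range (\<lambda>u. f u + (norm (u - x))^2 / (2*\<sigma>)))"

definition prox :: "real \<Rightarrow> ('a::real_normed_vector \<Rightarrow> real) \<Rightarrow> 'a \<Rightarrow> 'a" where
  "prox \<sigma> f x = (THE u. \<forall>v. f u + (norm (u - x))^2 / (2*\<sigma>) \<le> f v + (norm (v - x))^2 / (2*\<sigma>))"

definition grad :: "('a::real_inner \<Rightarrow> real) \<Rightarrow> 'a \<Rightarrow> 'a" where
  "grad f x = (THE g. (f has_derivative (\<lambda>h. g \<bullet> h)) (at x))"

definition subdiff :: "('a::real_inner \<Rightarrow> real) \<Rightarrow> 'a \<Rightarrow> 'a set" where
  "subdiff f x = {g. \<forall>z. f z \<ge> f x + g \<bullet> (z - x)}"

definition auglag ::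
  "real^'p^'n \<Rightarrow> real^'n \<Rightarrow> real \<Rightarrow> ('g::finite \<Rightarrow> 'p set) \<Rightarrow> ('g \<Rightarrow> real) \<Rightarrow>
   real \<Rightarrow> real^'n \<Rightarrow> real^'n \<Rightarrow> real^'p \<Rightarrow> real" where
  "auglag X y lam G wt \<sigma> w s \<beta> =
     y \<bullet> w - moreau \<sigma> Lfun (s + \<sigma> *\<^sub>R w) + (norm (s + \<sigma> *\<^sub>R w))^2 / (2*\<sigma>)
     - (norm s)^2 / (2*\<sigma>)
     - lam * moreau (\<sigma>*lam) (Psi G wt) (\<beta> - \<sigma> *\<^sub>R (transpose X *v w))
     + (norm (\<beta> - \<sigma> *\<^sub>R (transpose X *v w)))^2 / (2*\<sigma>) - (norm \<beta>)^2 / (2*\<sigma>)"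

definition Top ::
  "real^'p^'n \<Rightarrow> real^'n \<Rightarrow> real \<Rightarrow> ('g::finite \<Rightarrow> 'p set) \<Rightarrow> ('g \<Rightarrow> real) \<Rightarrow>
   ((real^'n) \<times> (real^'n) \<times> (real^'p)) \<Rightarrow> ((real^'n) \<times> (real^'n) \<times> (real^'p)) set" where
  "Top X y lam G wt z = (case z of (w, s, \<beta>) \<Rightarrow>
     {(w', s', \<beta>'). w' = y + s - X *v \<beta> \<and> s' \<in> (\<lambda>g. g - w) ` subdiff Lfun s \<and>
        \<beta>' \<in> (\<lambda>g. transpose X *v w + g) ` subdiff (\<lambda>b. lam * Psi G wt b) \<beta>})"

definition KKT ::
  "real^'p^'n \<Rightarrow> real^'n \<Rightarrow> real \<Rightarrow> ('g::finite \<Rightarrow> 'p set) \<Rightarrow> ('g \<Rightarrow> real) \<Rightarrow>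
   ((real^'n) \<times> (real^'n) \<times> (real^'p)) set" where
  "KKT X y lam G wt = {z. 0 \<in> Top X y lam G wt z}"

definition normM :: "real \<Rightarrow> ((real^'n) \<times> (real^'n) \<times> (real^'p)) \<Rightarrow> real" where
  "normM \<tau> z = (case z of (w, s, \<beta>) \<Rightarrow> sqrt (\<tau> * (norm w)^2 + (norm s)^2 + (norm \<beta>)^2))"

definition distM :: "real \<Rightarrow> ((real^'n) \<times> (real^'n) \<times> (real^'p)) \<Rightarrow> ((real^'n) \<times> (real^'n) \<times> (real^'p)) set \<Rightarrow> real" where
  "distM \<tau> x C = Inf ((\<lambda>z. normM \<tau> (x - z)) ` C)"

definition primal_opt ::
  "real^'p^'n \<Rightarrow> real^'n \<Rightarrow> real \<Rightarrow> ('g::finite \<Rightarrow> 'p set) \<Rightarrow> ('g \<Rightarrow> real) \<Rightarrow>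
   real^'n \<Rightarrow> real^'p \<Rightarrow> bool" where
  "primal_opt X y lam G wt s \<beta> \<longleftrightarrow> X *v \<beta> - s - y = 0 \<and>
     (\<forall>s' \<beta>'. X *v \<beta>' - s' - y = 0 \<longrightarrow>
        Lfun s + lam * Psi G wt \<beta> \<le> Lfun s' + lam * Psi G wt \<beta>')"

definition dual_obj ::
  "real^'p^'n \<Rightarrow> real^'n \<Rightarrow> real \<Rightarrow> ('g::finite \<Rightarrow> 'p set) \<Rightarrow> ('g \<Rightarrow> real) \<Rightarrow> real^'n \<Rightarrow> ereal" where
  "dual_obj X y lam G wt w = ereal (y \<bullet> w) + conjugate Lfun w
     + ereal lam * conjugate (Psi G wt) (- (1/lam) *\<^sub>R (transpose X *v w))"

definition dual_opt ::
  "real^'p^'n \<Rightarrow> real^'n \<Rightarrow> real \<Rightarrow> ('g::finite \<Rightarrow> 'p set) \<Rightarrow> ('g \<Rightarrow> real) \<Rightarrow> real^'n \<Rightarrow> bool" where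
  "dual_opt X y lam G wt w \<longleftrightarrow> (\<forall>w'. dual_obj X y lam G wt w \<le> dual_obj X y lam G wt w')"

end

theory Submission
  imports Defs
begin

text \<open>The method is an inexact proximal point iteration for \<open>T\<close>: with \<open>e = \<nabla>\<psi>\<^sub>k(w\<^sup>k\<^sup>+\<^sup>1)\<close>, the vector
  \<open>(e, 0, 0) + M (z\<^sup>k - z\<^sup>k\<^sup>+\<^sup>1) / \<sigma>\<^sub>k\<close> lies in \<open>T(z\<^sup>k\<^sup>+\<^sup>1)\<close>. Scaling the first block by \<open>sqrt \<tau>\<close> turns the
  \<open>M\<close>-norm into the Euclidean one, where monotonicity makes the iterates quasi-Fejer monotone with
  vanishing residuals, so that they converge to a zero of \<open>T\<close>. Zeros exist because the resolvents
  \<open>(I + c T)\<^sup>-\<^sup>1 0\<close>, obtained by minimising the proximal augmented Lagrangian, stay bounded as \<open>c \<rightarrow> \<infinity>\<close>.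

  For the rate, the error bound is applied at \<open>z\<^sup>k\<^sup>+\<^sup>1\<close> itself. When \<open>\<tau> \<noteq> 1\<close> this point may lie at Euclidean
  distance more than \<open>r\<close> from the zeros, since only \<open>M\<close>-distances are controlled along the iteration.
  Outside the tube of radius \<open>r\<close> the values of \<open>T\<close> still have norm at least \<open>r / \<kappa>\<close>, and this
  suffices because the \<open>M\<close>-distance of the iterates never exceeds \<open>sqrt \<gamma> * r\<close>.\<close>

section \<open>Proximal maps and Moreau envelopes\<close>

lemma continuous_attains_global_min:
  fixes g :: "'a::euclidean_space \<Rightarrow> real"
  assumes cont: "continuous_on UNIV g" and coercive: "\<And>v. R < norm (v - x) \<Longrightarrow> g x \<le> g v"
  obtains p where "\<And>v. g p \<le> g v"
proof -
  \<comment> \<open>The absolute value keeps the ball nonempty when \<open>R\<close> is negative;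
    its centre \<open>x\<close> is the competitor for points outside.\<close>
  have "\<exists>p\<in>cball x \<bar>R\<bar>. \<forall>v\<in>cball x \<bar>R\<bar>. g p \<le> g v"
    by (rule continuous_attains_inf) (auto intro: continuous_on_subset[OF cont])
  then obtain p where p: "p \<in> cball x \<bar>R\<bar>" "\<And>v. v \<in> cball x \<bar>R\<bar> \<Longrightarrow> g p \<le> g v"
    by auto
  have "g p \<le> g v" for v
  proof (cases "v \<in> cball x \<bar>R\<bar>")
    case False
    then have "R < norm (v - x)" by (auto simp: dist_norm norm_minus_commute)
    then have "g x \<le> g v" by (rule coercive)
    then show ?thesis using p(2)[of x] by simp
  qed (use p in auto)
  then show thesis by (rule that)
qed

text \<open>Fermat's rule: when \<open>p\<close> is compared with \<open>p + t d\<close>, convexity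
  of \<open>f\<close> and expansion of the square leave, after division by \<open>t\<close>, an
  error of order \<open>t\<close>, which vanishes as \<open>t\<close> tends to 0.\<close>

lemma subdiff_minimizer:
  fixes f :: "'a::real_inner \<Rightarrow> real"
  assumes conv: "convex_on UNIV f" and "\<sigma> > 0"
    and min: "\<And>v. f p + (norm (p - x))^2 / (2*\<sigma>) \<le> f v + (norm (v - x))^2 / (2*\<sigma>)"
  shows "(1/\<sigma>) *\<^sub>R (x - p) \<in> subdiff f p"
  unfolding subdiff_def
proof safe
  fix z
  define d where "d = z - p"
  have step: "f p + (1/\<sigma>) * ((x - p) \<bullet> d) - t * ((norm d)^2 / (2*\<sigma>)) \<le> f z"
    if t: "0 < t" "t \<le> 1" for t :: real
  proof -
    have "f (p + t *\<^sub>R d) \<le> (1 - t) * f p + t * f z"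
      using convex_onD[OF conv, of t p z] t
      by (simp add: d_def algebra_simps)
    moreover have "(norm (p + t *\<^sub>R d - x))^2 = (norm (p - x))^2 - 2 * t * ((x - p) \<bullet> d) + t^2 * (norm d)^2"
      unfolding power2_norm_eq_inner by (simp add: inner_simps algebra_simps inner_commute power2_eq_square)
    ultimately have "(norm (p - x))^2 / (2*\<sigma>) \<le> t * (f z - f p) +
       ((norm (p - x))^2 - 2 * t * ((x - p) \<bullet> d) + t^2 * (norm d)^2) / (2*\<sigma>)"
      using min[of "p + t *\<^sub>R d"] unfolding left_diff_distrib right_diff_distrib by simp
    then have "0 \<le> t * ((f z - f p) - (1/\<sigma>) * ((x - p) \<bullet> d) + t * ((norm d)^2 / (2*\<sigma>)))"
      using \<open>\<sigma> > 0\<close> by (simp add: field_simps power2_eq_square)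
    then show ?thesis using t by (simp add: zero_le_mult_iff)
  qed
  have "((\<lambda>t. f p + (1/\<sigma>) * ((x - p) \<bullet> d) - t * ((norm d)^2 / (2*\<sigma>))) \<longlongrightarrow>
      f p + (1/\<sigma>) * ((x - p) \<bullet> d) - 0 * ((norm d)^2 / (2*\<sigma>))) (at_right 0)"
    by (intro tendsto_intros)
  then have "f p + (1/\<sigma>) * ((x - p) \<bullet> d) - 0 * ((norm d)^2 / (2*\<sigma>)) \<le> f z"
  proof (rule tendsto_upperbound)
    show "\<forall>\<^sub>F t in at_right 0. f p + (1/\<sigma>) * ((x - p) \<bullet> d) - t * ((norm d)^2 / (2*\<sigma>)) \<le> f z"
      using step by (auto simp: eventually_at_right_field intro!: exI[of _ 1])
  qed simp
  then show "f p + ((1/\<sigma>) *\<^sub>R (x - p)) \<bullet> (z - p) \<le> f z" by (simp add: d_def)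
qed

text \<open>The subgradient inequality at \<open>p\<close> with the square completed around
  \<open>p + h\<close>. Taking \<open>h = 0\<close> gives uniqueness of the proximal point, general
  \<open>h\<close> the expansion of the Moreau envelope.\<close>

lemma regularized_ge_at_subgradient:
  fixes f :: "'a::real_inner \<Rightarrow> real"
  assumes "\<sigma> > 0" and sub: "(1/\<sigma>) *\<^sub>R (x - p) \<in> subdiff f p"
  shows "f p + (norm (p - x))^2 / (2*\<sigma>) + (x - p) \<bullet> h / \<sigma> + (norm (u - (p + h)))^2 / (2*\<sigma>)
    \<le> f u + (norm (u - (x + h)))^2 / (2*\<sigma>)"
proof -
  have "f p + (1/\<sigma>) * ((x - p) \<bullet> (u - p)) \<le> f u"
    using sub by (simp add: subdiff_def)
  moreover have "(norm (u - (x + h)))^2 / (2*\<sigma>) + (1/\<sigma>) * ((x - p) \<bullet> (u - p))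
    = (norm (p - x))^2 / (2*\<sigma>) + (x - p) \<bullet> h / \<sigma> + (norm (u - (p + h)))^2 / (2*\<sigma>)"
    unfolding power2_norm_eq_inner using \<open>\<sigma> > 0\<close>
    by (simp add: field_simps inner_simps inner_commute)
  ultimately show ?thesis by linarith
qed

text \<open>The completed square separates every competitor from \<open>p\<close>, so the definite
  description in \<open>prox\<close> has exactly one candidate. Proximal points can then be
  recognised by their optimality condition alone.\<close>

lemma prox_eqI:
  fixes f :: "'a::real_inner \<Rightarrow> real"
  assumes "\<sigma> > 0" and sub: "(1/\<sigma>) *\<^sub>R (x - p) \<in> subdiff f p"
  shows "prox \<sigma> f x = p"
  unfolding prox_def
proof (rule the_equality)
  have ge: "f p + (norm (p - x))^2 / (2*\<sigma>) + (norm (u - p))^2 / (2*\<sigma>)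
    \<le> f u + (norm (u - x))^2 / (2*\<sigma>)" for u
    using regularized_ge_at_subgradient[OF assms, of 0 u] by simp
  moreover have "0 \<le> (norm (u - p))^2 / (2*\<sigma>)" for u
    using \<open>\<sigma> > 0\<close> by simp
  ultimately show "\<forall>v. f p + (norm (p - x))^2 / (2*\<sigma>) \<le> f v + (norm (v - x))^2 / (2*\<sigma>)"
    by (smt (verit))
  fix u assume "\<forall>v. f u + (norm (u - x))^2 / (2*\<sigma>) \<le> f v + (norm (v - x))^2 / (2*\<sigma>)"
  then have "(norm (u - p))^2 / (2*\<sigma>) \<le> 0" using ge[of u] by (smt (verit))
  then show "u = p" using \<open>\<sigma> > 0\<close> by (simp add: divide_le_0_iff)
qed

lemma moreau_bounds:
  fixes f :: "'a::real_inner \<Rightarrow> real"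
  assumes "\<sigma> > 0" and sub: "(1/\<sigma>) *\<^sub>R (x - p) \<in> subdiff f p"
  shows moreau_ge: "f p + (norm (p - x))^2 / (2*\<sigma>) + (x - p) \<bullet> h / \<sigma> \<le> moreau \<sigma> f (x + h)"
    and moreau_le: "moreau \<sigma> f (x + h) \<le> f u + (norm (u - (x + h)))^2 / (2*\<sigma>)"
proof -
  have *: "f p + (norm (p - x))^2 / (2*\<sigma>) + (x - p) \<bullet> h / \<sigma> \<le> f u + (norm (u - (x + h)))^2 / (2*\<sigma>)" for u
  proof -
    have "0 \<le> (norm (u - (p + h)))^2 / (2*\<sigma>)" using \<open>\<sigma> > 0\<close> by simp
    then show ?thesis using regularized_ge_at_subgradient[OF assms, of h u] by linarith
  qed
  then show "f p + (norm (p - x))^2 / (2*\<sigma>) + (x - p) \<bullet> h / \<sigma> \<le> moreau \<sigma> f (x + h)"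
    unfolding moreau_def by (intro cINF_greatest) auto
  show "moreau \<sigma> f (x + h) \<le> f u + (norm (u - (x + h)))^2 / (2*\<sigma>)"
    unfolding moreau_def by (rule cINF_lower) (auto intro!: bdd_belowI2 *)
qed

text \<open>The envelope at \<open>x + h\<close> lies between its affine prediction and that
  prediction plus a multiple of the square of \<open>norm h\<close>: the lower bound comes from the
  subgradient, the upper one from keeping \<open>p\<close> as competitor.\<close>

lemma moreau_has_derivative:
  fixes f :: "'a::real_inner \<Rightarrow> real"
  assumes "\<sigma> > 0" and sub: "(1/\<sigma>) *\<^sub>R (x - p) \<in> subdiff f p"
  shows "(moreau \<sigma> f has_derivative (\<lambda>h. ((1/\<sigma>) *\<^sub>R (x - p)) \<bullet> h)) (at x)"
  unfolding has_derivative_at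
proof (intro conjI)
  let ?g = "(1/\<sigma>) *\<^sub>R (x - p)"
  show "bounded_linear ((\<bullet>) ?g)" by (rule bounded_linear_inner_right)
  have at: "moreau \<sigma> f x = f p + (norm (p - x))^2 / (2*\<sigma>)"
    using moreau_ge[OF assms, of 0] moreau_le[OF assms, of 0 p] by simp
  have q: "norm (moreau \<sigma> f (x + h) - moreau \<sigma> f x - ?g \<bullet> h) \<le> (norm h)^2 / (2*\<sigma>)" for h
  proof -
    have "(norm (p - (x + h)))^2 = (norm (p - x))^2 + 2 * ((x - p) \<bullet> h) + (norm h)^2"
      unfolding power2_norm_eq_inner by (simp add: inner_simps inner_commute)
    then have "moreau \<sigma> f (x + h) \<le> moreau \<sigma> f x + ?g \<bullet> h + (norm h)^2 / (2*\<sigma>)"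
      using moreau_le[OF assms, of h p] at by (simp add: add_divide_distrib)
    moreover have "moreau \<sigma> f x + ?g \<bullet> h \<le> moreau \<sigma> f (x + h)"
      using moreau_ge[OF assms, of h] at by simp
    ultimately show ?thesis by simp
  qed
  have lim: "((\<lambda>h. norm h / (2*\<sigma>)) \<longlongrightarrow> norm (0::'a) / (2*\<sigma>)) (at (0::'a))"
    using \<open>\<sigma> > 0\<close> by (intro tendsto_intros) auto
  show "(\<lambda>h. norm (moreau \<sigma> f (x + h) - moreau \<sigma> f x - ?g \<bullet> h) / norm h) \<midarrow>0\<rightarrow> 0"
  proof (rule tendsto_sandwich[OF _ _ tendsto_const])
    show "((\<lambda>h. norm h / (2*\<sigma>)) \<longlongrightarrow> 0) (at (0::'a))" using lim by simp
    show "\<forall>\<^sub>F h in at 0. norm (moreau \<sigma> f (x + h) - moreau \<sigma> f x - ?g \<bullet> h) / norm h \<le> norm h / (2*\<sigma>)"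
    proof (intro always_eventually allI)
      fix h :: 'a
      show "norm (moreau \<sigma> f (x + h) - moreau \<sigma> f x - ?g \<bullet> h) / norm h \<le> norm h / (2*\<sigma>)"
        using divide_right_mono[OF q[of h], of "norm h"] by (cases "h = 0") (simp_all add: power2_eq_square)
    qed
  qed simp
qed

lemma grad_eqI:
  assumes "(f has_derivative (\<lambda>h. g \<bullet> h)) (at x)"
  shows "grad f x = g"
  unfolding grad_def
proof (rule the_equality)
  show "(f has_derivative (\<lambda>h. g \<bullet> h)) (at x)" by (rule assms)
  fix g' assume "(f has_derivative (\<lambda>h. g' \<bullet> h)) (at x)"
  from fun_cong[OF has_derivative_unique[OF this assms]]
  show "g' = g" by (metis vector_eq_rdot)
qed

lemma subdiff_closed_graph:
  fixes f :: "'a::real_inner \<Rightarrow> real"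
  assumes cont: "continuous_on UNIV f" and mem: "\<And>k. g k \<in> subdiff f (x k)"
    and x: "x \<longlonglongrightarrow> x'" and g: "g \<longlonglongrightarrow> g'"
  shows "g' \<in> subdiff f x'"
  unfolding subdiff_def
proof safe
  fix z
  have "(\<lambda>k. f (x k)) \<longlonglongrightarrow> f x'"
    using continuous_on_tendsto_compose[OF cont x] by simp
  then have "(\<lambda>k. f (x k) + g k \<bullet> (z - x k)) \<longlonglongrightarrow> f x' + g' \<bullet> (z - x')"
    by (intro tendsto_intros x g)
  then show "f x' + g' \<bullet> (z - x') \<le> f z"
    by (rule LIMSEQ_le_const2) (use mem in \<open>auto simp: subdiff_def\<close>)
qed

lemma subdiff_monotone:
  assumes "g \<in> subdiff f x" "g' \<in> subdiff f x'"
  shows "0 \<le> (g - g') \<bullet> (x - x')"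
proof -
  have "f x + g \<bullet> (x' - x) \<le> f x'" "f x' + g' \<bullet> (x - x') \<le> f x"
    using assms by (auto simp: subdiff_def)
  then show ?thesis by (simp add: inner_simps)
qed

lemma subdiff_cmult:
  fixes f :: "'a::real_inner \<Rightarrow> real"
  assumes "c > 0" shows "subdiff (\<lambda>b. c * f b) x = (*\<^sub>R) c ` subdiff f x"
proof (rule set_eqI)
  fix g :: 'a
  have *: "c * f x + g \<bullet> d \<le> c * f z \<longleftrightarrow> f x + ((1/c) *\<^sub>R g) \<bullet> d \<le> f z" for z d
    using mult_le_cancel_left_pos[OF assms, of "f x + ((1/c) *\<^sub>R g) \<bullet> d" "f z"] assms
    by (simp add: distrib_left)
  have "g \<in> subdiff (\<lambda>b. c * f b) x \<longleftrightarrow> (1/c) *\<^sub>R g \<in> subdiff f x"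
    unfolding subdiff_def mem_Collect_eq * ..
  also have "\<dots> \<longleftrightarrow> g \<in> (*\<^sub>R) c ` subdiff f x"
  proof
    assume "(1/c) *\<^sub>R g \<in> subdiff f x"
    then have "c *\<^sub>R ((1/c) *\<^sub>R g) \<in> (*\<^sub>R) c ` subdiff f x" by (rule imageI)
    then show "g \<in> (*\<^sub>R) c ` subdiff f x" using assms by simp
  qed (use assms in auto)
  finally show "g \<in> subdiff (\<lambda>b. c * f b) x \<longleftrightarrow> g \<in> (*\<^sub>R) c ` subdiff f x" .
qed

section \<open>Nonnegative sublinear functions, the common type of \<open>Lfun\<close> and
  \<open>Psi\<close>\<close>

locale sublinear =
  fixes f :: "'a::euclidean_space \<Rightarrow> real"
  assumes nonneg: "0 \<le> f x"
    and subadditive: "f (x + y) \<le> f x + f y"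
    and homogeneous: "0 \<le> t \<Longrightarrow> f (t *\<^sub>R x) = t * f x"
begin

lemma at_zero [simp]: "f 0 = 0"
  using homogeneous[of 0 0] by simp

lemma convex: "convex_on UNIV f"
proof (rule convex_onI)
  fix t :: real and x y assume "0 < t" "t < 1"
  then show "f ((1 - t) *\<^sub>R x + t *\<^sub>R y) \<le> (1 - t) * f x + t * f y"
    using subadditive[of "(1 - t) *\<^sub>R x" "t *\<^sub>R y"] by (simp add: homogeneous)
qed simp

lemma continuous: "continuous_on UNIV f"
  by (rule convex_on_continuous[OF open_UNIV convex])

lemma subgradient_le: "g \<in> subdiff f x \<Longrightarrow> g \<bullet> z \<le> f z"
proof -
  assume "g \<in> subdiff f x"
  then have "f x + g \<bullet> (x + z - x) \<le> f (x + z)" unfolding subdiff_def by blast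
  then show ?thesis using subadditive[of x z] by simp
qed

lemma subgradient_inner: "g \<in> subdiff f x \<Longrightarrow> g \<bullet> x = f x"
proof (rule antisym)
  assume g: "g \<in> subdiff f x"
  then show "g \<bullet> x \<le> f x" by (rule subgradient_le)
  have "f x + g \<bullet> (0 - x) \<le> f 0" using g unfolding subdiff_def by blast
  then show "f x \<le> g \<bullet> x" by simp
qed

text \<open>The inequality does not involve \<open>x\<close>, which makes subgradients uniformly
  bounded; the equation is homogeneous in \<open>x\<close>, so positive scaling of \<open>x\<close>
  leaves the subdifferential unchanged.\<close>

lemma subdiff_iff: "g \<in> subdiff f x \<longleftrightarrow> (\<forall>z. g \<bullet> z \<le> f z) \<and> g \<bullet> x = f x"
proof
  show "g \<in> subdiff f x \<Longrightarrow> (\<forall>z. g \<bullet> z \<le> f z) \<and> g \<bullet> x = f x"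
    using subgradient_le subgradient_inner by blast
qed (auto simp: subdiff_def inner_simps)

lemma subdiff_scaleR: "t > 0 \<Longrightarrow> subdiff f (t *\<^sub>R x) = subdiff f x"
  by (auto simp: subdiff_iff homogeneous)

lemma subgradients_bounded:
  obtains K where "K \<ge> 0" "\<And>g x. g \<in> subdiff f x \<Longrightarrow> norm g \<le> K"
proof -
  have "bounded (f ` sphere 0 1)"
    by (intro compact_imp_bounded compact_continuous_image continuous_on_subset[OF continuous]) auto
  then obtain K where K: "K > 0" "\<And>x. norm x = 1 \<Longrightarrow> \<bar>f x\<bar> \<le> K"
    by (auto simp: bounded_pos)
  have "norm g \<le> K" if "g \<in> subdiff f x" for g x
  proof (cases "g = 0")
    case False
    have "norm g = g \<bullet> ((1 / norm g) *\<^sub>R g)"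
      using False by (simp add: power2_norm_eq_inner[symmetric] power2_eq_square)
    also have "\<dots> \<le> f ((1 / norm g) *\<^sub>R g)" by (rule subgradient_le[OF that])
    also have "\<dots> \<le> K" using K(2)[of "(1 / norm g) *\<^sub>R g"] False by simp
    finally show ?thesis .
  qed (use K in simp)
  then show thesis using that[of K] K by auto
qed

lemma prox_subgradient:
  assumes "\<sigma> > 0" shows "(1/\<sigma>) *\<^sub>R (x - prox \<sigma> f x) \<in> subdiff f (prox \<sigma> f x)"
proof -
  let ?g = "\<lambda>u. f u + (norm (u - x))^2 / (2*\<sigma>)"
  obtain p where p: "\<And>v. ?g p \<le> ?g v"
  proof (rule continuous_attains_global_min)
    show "continuous_on UNIV ?g" using assms by (intro continuous_intros continuous) auto
    fix v assume "sqrt (2 * \<sigma> * f x) < norm (v - x)"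
    then have "2 * \<sigma> * f x \<le> (norm (v - x))^2"
      using real_sqrt_le_iff[of "2 * \<sigma> * f x" "(norm (v - x))^2"] by simp
    then have "f x \<le> (norm (v - x))^2 / (2*\<sigma>)" using assms by (simp add: field_simps)
    then show "?g x \<le> ?g v" using nonneg[of v] by simp
  qed auto
  have "(1/\<sigma>) *\<^sub>R (x - p) \<in> subdiff f p"
    by (rule subdiff_minimizer[OF convex assms p])
  moreover from this have "prox \<sigma> f x = p" by (rule prox_eqI[OF assms])
  ultimately show ?thesis by simp
qed

text \<open>Links the updates of the method, which evaluate \<open>prox 1\<close> at a rescaled
  point, to the proximal map with parameter \<open>\<sigma>\<close> in the gradient of the augmented
  Lagrangian. By scaling invariance of subgradients both optimality conditions coincide.\<close>

lemma scaled_prox: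
  assumes "\<sigma> > 0" shows "\<sigma> *\<^sub>R prox 1 f ((1/\<sigma>) *\<^sub>R x) = prox \<sigma> f x"
proof -
  let ?p = "prox 1 f ((1/\<sigma>) *\<^sub>R x)"
  have "(1/\<sigma>) *\<^sub>R x - ?p \<in> subdiff f (\<sigma> *\<^sub>R ?p)"
    using prox_subgradient[of 1 "(1/\<sigma>) *\<^sub>R x"] by (simp add: subdiff_scaleR assms)
  then have "(1/\<sigma>) *\<^sub>R (x - \<sigma> *\<^sub>R ?p) \<in> subdiff f (\<sigma> *\<^sub>R ?p)"
    using assms by (simp add: algebra_simps)
  from prox_eqI[OF assms this] show ?thesis by simp
qed

text \<open>Each envelope occurs in the augmented Lagrangian together with such a square; in the
  difference of the two gradients only the proximal point survives.\<close>

lemma has_derivative_sq_norm_minus_moreau: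
  assumes "\<sigma> > 0"
  shows "((\<lambda>x. (norm x)^2 / (2*\<sigma>) - moreau \<sigma> f x) has_derivative (\<lambda>h. ((1/\<sigma>) *\<^sub>R prox \<sigma> f x) \<bullet> h)) (at x)"
proof -
  have "((\<lambda>x. (x \<bullet> x) / (2*\<sigma>) - moreau \<sigma> f x) has_derivative
      (\<lambda>h. (x \<bullet> h + h \<bullet> x) / (2*\<sigma>) - ((1/\<sigma>) *\<^sub>R (x - prox \<sigma> f x)) \<bullet> h)) (at x)"
    by (rule has_derivative_diff[OF _ moreau_has_derivative[OF assms prox_subgradient[OF assms]]])
      (use assms in \<open>auto intro!: derivative_eq_intros simp: field_simps\<close>)
  moreover have "(x \<bullet> h + h \<bullet> x) / (2*\<sigma>) - ((1/\<sigma>) *\<^sub>R (x - prox \<sigma> f x)) \<bullet> h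
      = ((1/\<sigma>) *\<^sub>R prox \<sigma> f x) \<bullet> h" for h
    using assms by (simp add: field_simps inner_simps inner_commute)
  ultimately show ?thesis unfolding power2_norm_eq_inner by simp
qed

lemma moreau_le_norm: "\<sigma> > 0 \<Longrightarrow> moreau \<sigma> f x \<le> (norm x)^2 / (2*\<sigma>)"
  using moreau_le[OF _ prox_subgradient, of \<sigma> x 0 0] by simp

end

section \<open>Proximal point iterations\<close>

text \<open>Convergence and rate rest on these two properties, which pass directly to the rescaled
  operator; solvability of the resolvent equation is added in
  \<open>maximal_monotone_operator\<close>.\<close>

locale closed_monotone_operator =
  fixes T :: "'a::euclidean_space \<Rightarrow> 'a set"
  assumes monotone: "\<lbrakk>u \<in> T x; v \<in> T y\<rbrakk> \<Longrightarrow> 0 \<le> (u - v) \<bullet> (x - y)"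
    and closed_graph: "\<lbrakk>\<And>k::nat. U k \<in> T (X k); X \<longlonglongrightarrow> x'; U \<longlonglongrightarrow> u'\<rbrakk> \<Longrightarrow> u' \<in> T x'"
begin

definition zeros :: "'a set" where
  "zeros = {x. 0 \<in> T x}"

lemma closed_zeros: "closed zeros"
  unfolding closed_sequential_limits zeros_def
  by (auto intro: closed_graph[of "\<lambda>_. 0"])

lemma resolvent_inner:
  assumes "\<sigma> > 0" "(1/\<sigma>) *\<^sub>R (y - x) \<in> T x" "z \<in> zeros"
  shows "0 \<le> (y - x) \<bullet> (x - z)"
proof -
  have "0 \<le> ((1/\<sigma>) *\<^sub>R (y - x) - 0) \<bullet> (x - z)"
    using assms by (intro monotone) (auto simp: zeros_def)
  then show ?thesis using \<open>\<sigma> > 0\<close> by (simp add: zero_le_divide_iff)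
qed

lemma resolvent_firmly_nonexpansive:
  assumes "\<sigma> > 0" "(1/\<sigma>) *\<^sub>R (y - x) \<in> T x" "z \<in> zeros"
  shows "(norm (x - z))^2 + (norm (y - x))^2 \<le> (norm (y - z))^2"
proof -
  have "(norm (y - z))^2 = (norm (x - z))^2 + (norm (y - x))^2 + 2 * ((y - x) \<bullet> (x - z))"
    unfolding power2_norm_eq_inner by (simp add: inner_simps inner_commute)
  then show ?thesis using resolvent_inner[OF assms] by simp
qed

lemma resolvent_nonexpansive:
  assumes "\<sigma> > 0" "(1/\<sigma>) *\<^sub>R (y - x) \<in> T x" "z \<in> zeros"
  shows "norm (x - z) \<le> norm (y - z)" "norm (y - x) \<le> norm (y - z)"
proof -
  have "0 \<le> (norm (x - z))^2" "0 \<le> (norm (y - x))^2" by simp_all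
  then have "(norm (x - z))^2 \<le> (norm (y - z))^2" "(norm (y - x))^2 \<le> (norm (y - z))^2"
    using resolvent_firmly_nonexpansive[OF assms] by linarith+
  then show "norm (x - z) \<le> norm (y - z)" "norm (y - x) \<le> norm (y - z)"
    by (simp_all add: power2_le_iff_abs_le)
qed

lemma bounded_vanishing_has_zero:
  assumes "bounded (range x)" "\<And>k::nat. U k \<in> T (x k)" "U \<longlonglongrightarrow> 0"
  obtains l r where "l \<in> zeros" "strict_mono r" "(x \<circ> r) \<longlonglongrightarrow> l"
proof -
  obtain l and r :: "nat \<Rightarrow> nat" where r: "strict_mono r" "(x \<circ> r) \<longlonglongrightarrow> l"
    using bounded_imp_convergent_subsequence[OF assms(1)] by blast
  have "0 \<in> T l"
  proof (rule closed_graph)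
    show "(U \<circ> r) k \<in> T ((x \<circ> r) k)" for k using assms(2) by simp
    show "(U \<circ> r) \<longlonglongrightarrow> 0" by (rule LIMSEQ_subseq_LIMSEQ[OF assms(3) r(1)])
  qed (rule r)
  then show thesis using that r by (auto simp: zeros_def)
qed

lemma infdist_attained:
  assumes "zeros \<noteq> {}" obtains q where "q \<in> zeros" "infdist x zeros = norm (x - q)"
  using infdist_attains_inf[OF closed_zeros assms, of x] by (auto simp: dist_norm)

lemma infdist_le_norm: "q \<in> zeros \<Longrightarrow> infdist x zeros \<le> norm (x - q)"
  using infdist_le[of q zeros x] by (simp add: dist_norm)

lemma infdist_perturb: "infdist (x + e) zeros \<le> infdist x zeros + norm e"
  using infdist_triangle[of "x + e" zeros x] by (simp add: dist_norm)

lemma infdist_resolvent: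
  assumes "zeros \<noteq> {}" "\<sigma> > 0" "(1/\<sigma>) *\<^sub>R (y - x) \<in> T x"
  shows "(infdist x zeros)^2 + (norm (y - x))^2 \<le> (infdist y zeros)^2"
    and "infdist x zeros \<le> infdist y zeros"
proof -
  obtain q where q: "q \<in> zeros" "infdist y zeros = norm (y - q)"
    using infdist_attained[OF assms(1)] .
  have "(infdist x zeros)^2 \<le> (norm (x - q))^2"
    by (intro power_mono infdist_le_norm q infdist_nonneg)
  then show sq: "(infdist x zeros)^2 + (norm (y - x))^2 \<le> (infdist y zeros)^2"
    using resolvent_firmly_nonexpansive[OF assms(2,3) q(1)] q(2) by simp
  then have "(infdist x zeros)^2 \<le> (infdist y zeros)^2"
    by (smt (verit) zero_le_power2)
  then show "infdist x zeros \<le> infdist y zeros"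
    by (simp add: power2_le_iff_abs_le infdist_nonneg)
qed

text \<open>Quasi-Fejer argument: distances to a zero grow by summable amounts, hence converge; firm
  nonexpansiveness then makes the residuals vanish, so a cluster point is a zero, and convergence of
  the distance to it upgrades the subsequence to the whole sequence.\<close>

lemma inexact_proximal_point_converges:
  assumes ne: "zeros \<noteq> {}" and \<sigma>: "0 < \<sigma>\<^sub>0" "\<And>k. \<sigma>\<^sub>0 \<le> \<sigma> k"
    and step: "\<And>k. (1 / \<sigma> k) *\<^sub>R (x k + e k - x (Suc k)) \<in> T (x (Suc k))"
    and err: "\<And>k. norm (e k) \<le> \<delta> k" and summable: "summable \<delta>"
  obtains l where "l \<in> zeros" "x \<longlonglongrightarrow> l"
proof -
  have \<sigma>_pos: "0 < \<sigma> k" for k using \<sigma> less_le_trans by blast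
  have \<delta>_nonneg: "0 \<le> \<delta> k" for k using err[of k] norm_ge_zero order_trans by blast
  have triangle: "norm (x k + e k - z) \<le> norm (x k - z) + \<delta> k" for k z
    using norm_triangle_ineq[of "x k - z" "e k"] err[of k] by (simp add: algebra_simps)
  have fejer: "norm (x (Suc k) - z) \<le> norm (x k - z) + \<delta> k" if "z \<in> zeros" for k z
    using resolvent_nonexpansive(1)[OF \<sigma>_pos step that, of k] triangle[of k z] by linarith
  have conv: "convergent (\<lambda>k. norm (x k - z))" if z: "z \<in> zeros" for z
  proof -
    \<comment> \<open>Subtracting the errors accumulated so far makes the sequence decreasing, and
      the total error bounds it from below.\<close>
    let ?b = "\<lambda>k. norm (x k - z) - sum \<delta> {..<k}"
    have "decseq ?b" using fejer[OF z] by (intro decseq_SucI) (simp add: algebra_simps)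
    moreover have "- suminf \<delta> \<le> ?b k" for k
      using sum_le_suminf[OF summable, of "{..<k}"] \<delta>_nonneg norm_ge_zero[of "x k - z"]
      by (auto simp del: norm_ge_zero)
    ultimately obtain b where "?b \<longlonglongrightarrow> b" using decseq_convergent[of ?b] by blast
    then have "(\<lambda>k. ?b k + sum \<delta> {..<k}) \<longlonglongrightarrow> b + suminf \<delta>"
      by (intro tendsto_add summable_LIMSEQ summable)
    then show ?thesis by (auto simp: convergent_def)
  qed
  obtain z where z: "z \<in> zeros" using ne by blast
  obtain a where a: "(\<lambda>k. norm (x k - z)) \<longlonglongrightarrow> a"
    using conv[OF z] by (auto simp: convergent_def)
  have sq: "(norm (x k + e k - x (Suc k)))^2 \<le> (norm (x k - z) + \<delta> k)^2 - (norm (x (Suc k) - z))^2" for k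
    using resolvent_firmly_nonexpansive[OF \<sigma>_pos step z, of k]
      power_mono[OF triangle[of k z] norm_ge_zero, of 2] by linarith
  \<comment> \<open>Both squares have the same limit, so this bound on the squared displacement
    tends to 0.\<close>
  have "(\<lambda>k. (norm (x k - z) + \<delta> k)^2 - (norm (x (Suc k) - z))^2) \<longlonglongrightarrow> (a + 0)^2 - a^2"
    by (intro tendsto_intros a LIMSEQ_Suc[OF a] summable_LIMSEQ_zero summable)
  then have lim: "(\<lambda>k. (norm (x k - z) + \<delta> k)^2 - (norm (x (Suc k) - z))^2) \<longlonglongrightarrow> 0" by simp
  have "(\<lambda>k. (norm (x k + e k - x (Suc k)))^2) \<longlonglongrightarrow> 0"
    by (rule Lim_null_comparison[OF _ lim]) (simp add: sq)
  then have "(\<lambda>k. sqrt ((norm (x k + e k - x (Suc k)))^2)) \<longlonglongrightarrow> sqrt 0"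
    by (rule tendsto_real_sqrt)
  then have "(\<lambda>k. (1 / \<sigma>\<^sub>0) * norm (x k + e k - x (Suc k))) \<longlonglongrightarrow> 0"
    by (intro tendsto_mult_right_zero) simp
  then have U: "(\<lambda>k. (1 / \<sigma> k) *\<^sub>R (x k + e k - x (Suc k))) \<longlonglongrightarrow> 0"
  proof (rule Lim_null_comparison[rotated])
    have "1 / \<sigma> k \<le> 1 / \<sigma>\<^sub>0" for k using \<sigma> by (simp add: frac_le)
    then have "norm ((1 / \<sigma> k) *\<^sub>R (x k + e k - x (Suc k))) \<le> (1 / \<sigma>\<^sub>0) * norm (x k + e k - x (Suc k))" for k
      using mult_right_mono[of "1 / \<sigma> k" "1 / \<sigma>\<^sub>0" "norm (x k + e k - x (Suc k))"] \<sigma>_pos[of k]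
      by (simp del: times_divide_eq_left)
    then show "\<forall>\<^sub>F k in sequentially. norm ((1 / \<sigma> k) *\<^sub>R (x k + e k - x (Suc k))) \<le> (1 / \<sigma>\<^sub>0) * norm (x k + e k - x (Suc k))"
      by simp
  qed
  have "bounded (range (\<lambda>k. norm (x k - z)))"
    by (rule convergent_imp_bounded[OF a])
  then obtain B where B: "\<And>k. norm (x k - z) \<le> B" by (auto simp: bounded_iff)
  have "norm (x k) \<le> B + norm z" for k
    using norm_triangle_sub[of "x k" z] B[of k] by linarith
  then have "bounded (range (\<lambda>k. x (Suc k)))" by (auto simp: bounded_iff)
  from bounded_vanishing_has_zero[OF this step U]
  obtain l r where l: "l \<in> zeros" "strict_mono r" "((\<lambda>k. x (Suc k)) \<circ> r) \<longlonglongrightarrow> l" by blast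
  obtain b where b: "(\<lambda>k. norm (x k - l)) \<longlonglongrightarrow> b"
    using conv[OF l(1)] by (auto simp: convergent_def)
  have "((\<lambda>k. norm (x (Suc k) - l)) \<circ> r) \<longlonglongrightarrow> b"
    by (intro LIMSEQ_subseq_LIMSEQ[OF LIMSEQ_Suc[OF b] l(2)])
  moreover have "((\<lambda>k. norm (x (Suc k) - l)) \<circ> r) \<longlonglongrightarrow> norm (l - l)"
    using tendsto_norm[OF tendsto_diff[OF l(3) tendsto_const[of l]]] by (simp add: o_def)
  ultimately have "b = 0" using LIMSEQ_unique by fastforce
  then have "x \<longlonglongrightarrow> l" using b LIM_zero_cancel tendsto_norm_zero_iff by blast
  with l(1) show thesis by (rule that)
qed

text \<open>With \<open>E\<close> the distance at the perturbed point \<open>x + e\<close>, the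
  error bound and firm nonexpansiveness give \<open>D' \<le> \<theta> * E\<close>, and the relative
  error criterion gives \<open>(1 - \<delta>) * E \<le> D\<close>. The resulting factor
  \<open>\<theta> / (1 - \<delta>)\<close> is finally relaxed to the stated one.\<close>

lemma inexact_proximal_point_rate:
  assumes ne: "zeros \<noteq> {}" and \<sigma>: "\<sigma> > 0" and \<delta>: "0 \<le> \<delta>" "\<delta> < 1" and K: "K > 0"
    and step: "(1/\<sigma>) *\<^sub>R (x + e - x') \<in> T x'" and err: "norm e \<le> \<delta> * norm (x' - x)"
    and error_bound: "infdist x' zeros \<le> K * norm ((1/\<sigma>) *\<^sub>R (x + e - x'))"
  shows "infdist x' zeros \<le> (1 / (1 - \<delta>)) * (\<delta> + (1 + \<delta>) * (K / sqrt (\<sigma>^2 + K^2))) * infdist x zeros"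
proof -
  define D D' E n where "D = infdist x zeros" "D' = infdist x' zeros" "E = infdist (x + e) zeros"
    "n = norm (x + e - x')"
  define m where "m = norm (x' - x)"
  define \<theta> where "\<theta> = K / sqrt (\<sigma>^2 + K^2)"
  have nonneg: "0 \<le> D" "0 \<le> D'" "0 \<le> E" "0 \<le> n" "0 \<le> m"
    by (simp_all add: D_D'_E_n_def m_def infdist_nonneg)
  have sqrt_pos: "0 < sqrt (\<sigma>^2 + K^2)" using \<sigma> K by (simp add: add_pos_pos)
  then have \<theta>: "0 \<le> \<theta>" using K by (simp add: \<theta>_def)
  have "D' \<le> K * n / \<sigma>" using error_bound \<sigma> by (simp add: D_D'_E_n_def)
  then have "\<sigma> * D' \<le> K * n" using \<sigma> by (simp add: field_simps)
  then have "(\<sigma> * D')^2 \<le> (K * n)^2" using \<sigma> nonneg by (intro power_mono) auto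
  \<comment> \<open>Adding this to the previous bound eliminates \<open>n\<close> and leaves
    \<open>(\<sigma>^2 + K^2) * D'^2 \<le> K^2 * E^2\<close>.\<close>
  moreover have "K^2 * (D'^2 + n^2) \<le> K^2 * E^2"
    using infdist_resolvent(1)[OF ne \<sigma> step] by (intro mult_left_mono) (auto simp: D_D'_E_n_def)
  ultimately have "(D' * sqrt (\<sigma>^2 + K^2))^2 \<le> (K * E)^2"
    by (simp add: power_mult_distrib algebra_simps)
  then have "D' * sqrt (\<sigma>^2 + K^2) \<le> K * E"
    by (rule power2_le_imp_le) (use K nonneg in simp)
  then have "D' \<le> \<theta> * E" using sqrt_pos by (simp add: \<theta>_def field_simps)
  \<comment> \<open>The error is relative to \<open>m\<close>, so \<open>m\<close> has to be bounded
    by \<open>D\<close>: monotonicity at \<open>x'\<close> against a zero \<open>q\<close> nearest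
    to \<open>x\<close>, with the mixed term absorbed by a square, gives
    \<open>(1 - \<delta>) * m \<le> D\<close>.\<close>
  moreover have "(1 - \<delta>) * E \<le> D"
  proof -
    obtain q where q: "q \<in> zeros" "D = norm (x - q)"
      using infdist_attained[OF ne] unfolding D_D'_E_n_def by metis
    have "- (e \<bullet> (x' - q)) \<le> (x - x') \<bullet> (x' - q)"
      using resolvent_inner[OF \<sigma> step q(1)] by (simp add: inner_simps)
    moreover have "D^2 = m^2 + (norm (x' - q))^2 + 2 * ((x - x') \<bullet> (x' - q))"
      unfolding q(2) m_def power2_norm_eq_inner by (simp add: inner_simps inner_commute)
    moreover have "e \<bullet> (x' - q) \<le> \<delta> * m * norm (x' - q)"
      using norm_cauchy_schwarz[of e "x' - q"] mult_right_mono[OF err norm_ge_zero[of "x' - q"]]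
      by (simp add: m_def)
    ultimately have "m^2 + (norm (x' - q))^2 - 2 * (\<delta> * m * norm (x' - q)) \<le> D^2" by linarith
    moreover have "0 \<le> (norm (x' - q) - \<delta> * m)^2" by simp
    moreover have "0 \<le> 2 * (\<delta> * (1 - \<delta>)) * m^2" using \<delta> by simp
    ultimately have "((1 - \<delta>) * m)^2 \<le> D^2"
      by (simp add: power2_eq_square algebra_simps)
    then have "(1 - \<delta>) * m \<le> D" using nonneg(1) by (rule power2_le_imp_le)
    then have "\<delta> * ((1 - \<delta>) * m) \<le> \<delta> * D" using \<delta> by (intro mult_left_mono)
    moreover have "(1 - \<delta>) * E \<le> (1 - \<delta>) * (D + \<delta> * m)"
      using infdist_perturb[of x e] err \<delta> by (intro mult_left_mono) (auto simp: D_D'_E_n_def m_def)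
    ultimately show ?thesis by (simp add: algebra_simps)
  qed
  ultimately have "(1 - \<delta>) * D' \<le> (1 - \<delta>) * (\<theta> * E)" "\<theta> * ((1 - \<delta>) * E) \<le> \<theta> * D"
    using \<theta> \<delta> by (auto intro!: mult_left_mono)
  then have "(1 - \<delta>) * D' \<le> \<theta> * D" by (simp only: mult.left_commute[of "1 - \<delta>"])
  also have "\<dots> \<le> (\<delta> + (1 + \<delta>) * \<theta>) * D"
    using nonneg \<theta> \<delta> by (intro mult_right_mono) (auto simp: algebra_simps)
  finally have "D' \<le> (\<delta> + (1 + \<delta>) * \<theta>) * D / (1 - \<delta>)"
    using \<delta> by (simp add: field_simps)
  then show ?thesis by (simp add: D_D'_E_n_def \<theta>_def)
qed

text \<open>Duality of \<open>S\<close> and \<open>S'\<close> preserves the pairing and hence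
  monotonicity. With \<open>S = weight_map \<tau>\<close> and
  \<open>S' = weight_map (1/\<tau>)\<close> the result is \<open>T\<close> in coordinates where the
  weighted norm is Euclidean.\<close>

lemma change_of_variables:
  assumes S: "bounded_linear S" and S': "bounded_linear S'" and dual: "\<And>u x. S u \<bullet> S' x = u \<bullet> x"
  shows "closed_monotone_operator (\<lambda>x. {u. S u \<in> T (S' x)})"
proof (unfold_locales, safe)
  fix u x v y assume "S u \<in> T (S' x)" "S v \<in> T (S' y)"
  from monotone[OF this] show "0 \<le> (u - v) \<bullet> (x - y)"
    by (simp add: linear_diff[OF bounded_linear.linear[OF S], symmetric]
        linear_diff[OF bounded_linear.linear[OF S'], symmetric] dual)
next
  fix U X x' u' assume mem: "\<And>k::nat. U k \<in> {u. S u \<in> T (S' (X k))}" and lim: "X \<longlonglongrightarrow> x'" "U \<longlonglongrightarrow> u'"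
  show "S u' \<in> T (S' x')"
  proof (rule closed_graph[of "\<lambda>k. S (U k)" "\<lambda>k. S' (X k)"])
    show "S (U k) \<in> T (S' (X k))" for k using mem by simp
  qed (intro bounded_linear.tendsto[OF S] bounded_linear.tendsto[OF S'] lim)+
qed

end

section \<open>Solvable resolvent equations: existence of zeros and an error bound outside the
  tube\<close>

locale maximal_monotone_operator = closed_monotone_operator +
  assumes resolvent_exists: "c > 0 \<Longrightarrow> \<exists>u. (1/c) *\<^sub>R (z - u) \<in> T u"
begin

text \<open>As \<open>c\<close> tends to infinity the values \<open>(z - u) / c\<close> of
  \<open>T\<close> vanish while the resolvents \<open>u\<close> stay bounded, so a cluster point of
  them is a zero.\<close>

lemma zeros_nonempty_if_resolvents_bounded:
  assumes "\<And>c u. \<lbrakk>c \<ge> c\<^sub>0; (1/c) *\<^sub>R (z - u) \<in> T u\<rbrakk> \<Longrightarrow> norm u \<le> B"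
  shows "zeros \<noteq> {}"
proof -
  define c where "c k = max 1 c\<^sub>0 + real k" for k
  have c: "c k > 0" "c k \<ge> c\<^sub>0" for k by (auto simp: c_def)
  have "\<forall>k. \<exists>u. (1 / c k) *\<^sub>R (z - u) \<in> T u" using resolvent_exists[OF c(1)] by blast
  from choice[OF this] obtain u where "\<forall>k. (1 / c k) *\<^sub>R (z - u k) \<in> T (u k)" ..
  then have u: "(1 / c k) *\<^sub>R (z - u k) \<in> T (u k)" for k by blast
  have B: "norm (u k) \<le> B" for k using assms[OF c(2) u] .
  have inf: "filterlim c at_top sequentially"
    unfolding c_def by (intro filterlim_tendsto_add_at_top[OF tendsto_const] filterlim_real_sequentially)
  have "(\<lambda>k. (norm z + B) / c k) \<longlonglongrightarrow> 0"
    by (rule real_tendsto_divide_at_top[OF tendsto_const inf])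
  then have "(\<lambda>k. (1 / c k) *\<^sub>R (z - u k)) \<longlonglongrightarrow> 0"
  proof (rule Lim_null_comparison[rotated], intro always_eventually allI)
    fix k
    have "norm (z - u k) \<le> norm z + B" using norm_triangle_ineq4[of z "u k"] B[of k] by linarith
    then show "norm ((1 / c k) *\<^sub>R (z - u k)) \<le> (norm z + B) / c k"
      using c(1)[of k] by (simp add: divide_right_mono)
  qed
  moreover have "bounded (range u)" using B by (auto simp: bounded_iff)
  ultimately obtain l where "l \<in> zeros" using bounded_vanishing_has_zero[of u, OF _ u] by blast
  then show ?thesis by blast
qed

text \<open>An error bound on the tube of radius \<open>r\<close> around the zeros controls \<open>T\<close> outside the tube as well:
  the resolvent curve \<open>c \<mapsto> (I + c T)\<^sup>-\<^sup>1 z\<close> is Lipschitz, starts at \<open>z\<close> and enters the tube, and the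
  norms of the attached values of \<open>T\<close> along it never exceed that of any element of \<open>T z\<close>.\<close>

lemma truncated_error_bound:
  assumes ne: "zeros \<noteq> {}" and "r > 0" and \<kappa>: "\<kappa> > 0" and v: "v \<in> T z"
    and error_bound: "\<And>z. infdist z zeros \<le> r \<Longrightarrow> infdist z zeros \<le> \<kappa> * infdist 0 (T z)"
  shows "min (infdist z zeros) r \<le> \<kappa> * norm v"
proof -
  have local: "infdist u zeros \<le> \<kappa> * norm V" if "V \<in> T u" "infdist u zeros \<le> r" for u V
    using error_bound[OF that(2)] infdist_le[OF that(1), of 0] \<kappa>
    by (smt (verit) dist_0_norm mult_left_mono)
  show ?thesis
  proof (cases "infdist z zeros \<le> r")
    case True
    then show ?thesis using local[OF v] by simp
  next
    case False
    \<comment> \<open>\<open>V c\<close> is the value of \<open>T\<close> attached to the resolvent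
      \<open>z - c V c\<close>; at \<open>c = 0\<close> it is fixed to the given \<open>v\<close>,
      so that the curve starts at \<open>z\<close> with that very value.\<close>
    have "\<exists>V. V \<in> T (z - c *\<^sub>R V) \<and> (c = 0 \<longrightarrow> V = v)" if "c \<ge> 0" for c
    proof (cases "c = 0")
      case False
      then have "c > 0" using that by simp
      from resolvent_exists[OF this, of z] obtain u where "(1/c) *\<^sub>R (z - u) \<in> T u" ..
      then have "(1/c) *\<^sub>R (z - u) \<in> T (z - c *\<^sub>R ((1/c) *\<^sub>R (z - u)))" using False by simp
      then show ?thesis using False by blast
    qed (use v in auto)
    then obtain V where V: "\<And>c. c \<ge> 0 \<Longrightarrow> V c \<in> T (z - c *\<^sub>R V c)" and V0: "V 0 = v"
      by (metis order_refl)
    define u where "u c = z - c *\<^sub>R V c" for c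
    have Vu: "V c \<in> T (u c)" if "c \<ge> 0" for c using V[OF that] by (simp add: u_def)
    have norm_V: "norm (V c) \<le> norm v" if "c \<ge> 0" for c
    proof (cases "c = 0")
      case False
      then have c: "c > 0" using that by simp
      have "0 \<le> (v - V c) \<bullet> (z - u c)" using monotone[OF v Vu[OF that]] .
      then have "0 \<le> c * ((v - V c) \<bullet> V c)" by (simp add: u_def)
      then have "(norm (V c))^2 \<le> v \<bullet> V c"
        using c by (simp add: zero_le_mult_iff inner_diff_left power2_norm_eq_inner)
      also have "\<dots> \<le> norm v * norm (V c)" by (rule norm_cauchy_schwarz)
      finally show ?thesis
        by (metis mult_right_le_imp_le norm_ge_zero order.order_iff_strict power2_eq_square)
    qed (simp add: V0)
    have lipschitz: "dist (u c) (u c') \<le> norm v * dist c c'" if cc: "c \<ge> 0" "c' \<ge> 0" for c c'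
    proof -
      let ?d = "u c - u c'"
      have "0 \<le> c * ((V c - V c') \<bullet> ?d)"
        using monotone[OF Vu[OF cc(1)] Vu[OF cc(2)]] cc by simp
      also have "c *\<^sub>R (V c - V c') = (c' - c) *\<^sub>R V c' - ?d" by (simp add: u_def algebra_simps)
      then have "c * ((V c - V c') \<bullet> ?d) = ((c' - c) *\<^sub>R V c' - ?d) \<bullet> ?d"
        by (metis inner_scaleR_left)
      finally have "(norm ?d)^2 \<le> ((c' - c) *\<^sub>R V c') \<bullet> ?d"
        by (simp add: inner_diff_left power2_norm_eq_inner)
      also have "\<dots> \<le> norm ((c' - c) *\<^sub>R V c') * norm ?d" by (rule norm_cauchy_schwarz)
      finally have "norm ?d \<le> norm ((c' - c) *\<^sub>R V c')"
        by (metis mult_right_le_imp_le norm_ge_zero order.order_iff_strict power2_eq_square)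
      also have "\<dots> \<le> \<bar>c' - c\<bar> * norm v" using norm_V[OF cc(2)] by (simp add: mult_left_mono)
      finally show ?thesis by (simp add: dist_norm abs_minus_commute mult.commute)
    qed
    have cont: "continuous_on {0..C} (\<lambda>c. infdist (u c) zeros)" for C
      by (intro continuous_intros lipschitz_on_continuous_on[of "norm v"] lipschitz_onI lipschitz) auto
    \<comment> \<open>Along integer parameters the points stay bounded and the values vanish, so a
      subsequence approaches a zero and enters the tube.\<close>
    obtain C where C: "C \<ge> 0" "infdist (u C) zeros \<le> r"
    proof -
      obtain q where q: "q \<in> zeros" using ne by blast
      let ?c = "\<lambda>k. real (Suc k)"
      have bound: "norm (z - u (?c k)) \<le> norm (z - q)" for k
      proof (rule resolvent_nonexpansive(2)[OF _ _ q])
        show "(1 / ?c k) *\<^sub>R (z - u (?c k)) \<in> T (u (?c k))"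
          using Vu[of "?c k"] by (simp add: u_def)
      qed simp
      have "norm (u (?c k)) \<le> norm z + norm (z - q)" for k
        using bound[of k] norm_triangle_ineq3[of z "u (?c k)"] by linarith
      then have bdd: "bounded (range (\<lambda>k. u (?c k)))" by (auto simp: bounded_iff)
      have "(\<lambda>k. norm (z - q) * inverse (?c k)) \<longlonglongrightarrow> 0"
        by (intro tendsto_mult_right_zero LIMSEQ_inverse_real_of_nat)
      then have "(\<lambda>k. V (?c k)) \<longlonglongrightarrow> 0"
      proof (rule Lim_null_comparison[rotated], intro always_eventually allI)
        fix k
        have "?c k * norm (V (?c k)) \<le> norm (z - q)" using bound[of k] by (simp add: u_def)
        then show "norm (V (?c k)) \<le> norm (z - q) * inverse (?c k)"
          by (simp add: field_simps)
      qed
      then obtain l s where l: "l \<in> zeros" "((\<lambda>k. u (?c k)) \<circ> s) \<longlonglongrightarrow> l"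
        using bounded_vanishing_has_zero[OF bdd Vu] of_nat_0_le_iff by blast
      have "(\<lambda>k. infdist (((\<lambda>k. u (?c k)) \<circ> s) k) zeros) \<longlonglongrightarrow> infdist l zeros"
        by (intro tendsto_infdist l)
      then have "\<forall>\<^sub>F k in sequentially. infdist (((\<lambda>k. u (?c k)) \<circ> s) k) zeros < r"
        using l(1) \<open>r > 0\<close> by (intro order_tendstoD(2)) auto
      then obtain k where "infdist (u (?c (s k))) zeros < r"
        by (auto simp: eventually_sequentially)
      then show thesis using that[of "?c (s k)"] by simp
    qed
    \<comment> \<open>At the crossing the distance is exactly \<open>r\<close>, so the assumed bound
      still applies there and yields \<open>r \<le> \<kappa> * norm (V c)\<close>.\<close>
    have "\<exists>c\<ge>0. c \<le> C \<and> infdist (u c) zeros = r"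
      by (rule IVT2') (use C False V0 cont in \<open>auto simp: u_def\<close>)
    then obtain c where c: "c \<ge> 0" "infdist (u c) zeros = r" by blast
    have "r \<le> \<kappa> * norm (V c)" using local[OF Vu[OF c(1)]] c(2) by simp
    also have "\<dots> \<le> \<kappa> * norm v" using norm_V[OF c(1)] \<kappa> by simp
    finally show ?thesis by simp
  qed
qed

end

section \<open>The penalised rank regression problem\<close>

lemma conjugate_ge: "ereal (x \<bullet> u - f u) \<le> conjugate f x"
  unfolding conjugate_def by (rule SUP_upper) simp

text \<open>Equality case of the Fenchel-Young inequality; it evaluates the dual objective at a KKT
  point.\<close>

lemma conjugate_subgradient:
  assumes "g \<in> subdiff f x" shows "conjugate f g = ereal (g \<bullet> x - f x)"
proof (rule antisym[OF _ conjugate_ge])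
  have "g \<bullet> u - f u \<le> g \<bullet> x - f x" for u
  proof -
    have "f x + g \<bullet> (u - x) \<le> f u" using assms unfolding subdiff_def by blast
    then show ?thesis by (simp add: inner_simps)
  qed
  then show "conjugate f g \<le> ereal (g \<bullet> x - f x)"
    unfolding conjugate_def by (intro SUP_least) simp
qed

lemma inner_transpose_mult:
  fixes X :: "real^'p^'n" shows "(transpose X *v a) \<bullet> d = a \<bullet> (X *v d)"
  by (simp add: dot_lmul_matrix)

lemma inner_mult_transpose:
  fixes X :: "real^'p^'n" shows "d \<bullet> (a v* X) = a \<bullet> (X *v d)"
  by (metis dot_lmul_matrix inner_commute)

lemma sublinear_Lfun: "sublinear (Lfun :: real^'n \<Rightarrow> real)"
proof
  let ?c = "1 / (real CARD('n) * (real CARD('n) - 1))"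
  have "1 \<le> CARD('n)" by (simp add: Suc_leI)
  then have c: "0 \<le> ?c" by simp
  fix x y :: "real^'n" and t :: real
  show "0 \<le> Lfun x" unfolding Lfun_def by (intro mult_nonneg_nonneg c sum_nonneg) simp
  have "(\<Sum>i\<in>UNIV. \<Sum>j\<in>UNIV - {i}. \<bar>(x + y)$i - (x + y)$j\<bar>)
      \<le> (\<Sum>i\<in>UNIV. \<Sum>j\<in>UNIV - {i}. \<bar>x$i - x$j\<bar> + \<bar>y$i - y$j\<bar>)"
    by (intro sum_mono) simp
  then show "Lfun (x + y) \<le> Lfun x + Lfun y"
    unfolding Lfun_def distrib_left[symmetric] by (intro mult_left_mono c) (simp add: sum.distrib)
  assume "0 \<le> t"
  then have "\<bar>(t *\<^sub>R x)$i - (t *\<^sub>R x)$j\<bar> = t * \<bar>x$i - x$j\<bar>" for i j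
    by (simp add: abs_mult right_diff_distrib[symmetric])
  then show "Lfun (t *\<^sub>R x) = t * Lfun x"
    by (simp add: Lfun_def sum_distrib_left[symmetric])
qed

lemma Psi_L2_set: "Psi G wt \<beta> = (\<Sum>l\<in>UNIV. wt l * L2_set (($) \<beta>) (G l))"
  by (simp add: Psi_def L2_set_def)

lemma sublinear_Psi:
  fixes G :: "'g::finite \<Rightarrow> 'p::finite set"
  assumes "\<And>l. wt l > 0" shows "sublinear (Psi G wt)"
proof
  have wt: "0 \<le> wt l" for l using assms[of l] by simp
  fix x y :: "real^'p" and t :: real
  show "0 \<le> Psi G wt x" unfolding Psi_L2_set by (intro sum_nonneg mult_nonneg_nonneg wt L2_set_nonneg)
  have "L2_set (($) (x + y)) A \<le> L2_set (($) x) A + L2_set (($) y) A" for A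
    using L2_set_triangle_ineq[of "($) x" "($) y" A] by (simp add: L2_set_def)
  then show "Psi G wt (x + y) \<le> Psi G wt x + Psi G wt y"
    unfolding Psi_L2_set sum.distrib[symmetric] distrib_left[symmetric]
    by (intro sum_mono mult_left_mono wt)
  assume "0 \<le> t"
  then have "L2_set (($) (t *\<^sub>R x)) A = t * L2_set (($) x) A" for A
    using L2_set_right_distrib[of t "($) x" A] by (simp add: L2_set_def)
  then show "Psi G wt (t *\<^sub>R x) = t * Psi G wt x"
    by (simp add: Psi_L2_set sum_distrib_left mult.left_commute)
qed

text \<open>Every coordinate lies in some group of positive weight, so the penalty controls each
  coordinate and thus the norm. This coercivity bounds the coefficient block in the existence proof
  for KKT points.\<close>

lemma norm_le_Psi:
  fixes G :: "'g::finite \<Rightarrow> 'p::finite set"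
  assumes wt: "\<And>l. wt l > 0" and cover: "(\<Union>l. G l) = UNIV"
  obtains C where "C \<ge> 0" "\<And>d. norm d \<le> C * Psi G wt d"
proof -
  have "\<forall>i. \<exists>l. i \<in> G l" using cover by blast
  then obtain h where h: "\<And>i. i \<in> G (h i)" by metis
  have comp: "\<bar>d$i\<bar> \<le> (1 / wt (h i)) * Psi G wt d" for d i
  proof -
    have "wt (h i) * \<bar>d$i\<bar> \<le> wt (h i) * L2_set (($) d) (G (h i))"
      using member_le_L2_set[of "G (h i)" i "\<lambda>j. \<bar>d$j\<bar>"] h wt[of "h i"]
      by (intro mult_left_mono) (auto simp: L2_set_def)
    also have "\<dots> \<le> Psi G wt d"
      unfolding Psi_L2_set using wt by (intro member_le_sum) (auto simp: less_imp_le L2_set_nonneg)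
    finally show ?thesis using wt[of "h i"] by (simp add: field_simps)
  qed
  have "norm d \<le> (\<Sum>i\<in>UNIV. 1 / wt (h i)) * Psi G wt d" for d
    unfolding sum_distrib_right using norm_le_l1_cart[of d] sum_mono[of UNIV, OF comp[of d]]
    by (rule order_trans)
  then show thesis using that[of "\<Sum>i\<in>UNIV. 1 / wt (h i)"] wt by (auto simp: sum_nonneg less_imp_le)
qed

section \<open>Reduction of the weighted norm to the Euclidean norm by the square root of
  \<open>M\<close>\<close>

definition weight_map :: "real \<Rightarrow> (real^'n) \<times> (real^'n) \<times> (real^'p) \<Rightarrow> (real^'n) \<times> (real^'n) \<times> (real^'p)" where
  "weight_map \<tau> z = (sqrt \<tau> *\<^sub>R fst z, snd z)"

lemma bounded_linear_weight_map: "bounded_linear (weight_map \<tau>)"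
  unfolding weight_map_def
  by (intro bounded_linear_Pair bounded_linear_scaleR_right[THEN bounded_linear_compose]
      bounded_linear_fst bounded_linear_snd)

lemma weight_map_zero: "weight_map \<tau> 0 = 0"
  by (rule linear_0[OF bounded_linear.linear[OF bounded_linear_weight_map]])

lemma weight_map_diff: "weight_map \<tau> (x - z) = weight_map \<tau> x - weight_map \<tau> z"
  by (simp add: weight_map_def scaleR_diff_right)

lemma weight_map_inverse:
  assumes "\<tau> > 0"
  shows "weight_map (1/\<tau>) (weight_map \<tau> z) = z" "weight_map \<tau> (weight_map (1/\<tau>) z) = z"
  using assms by (simp_all add: weight_map_def real_sqrt_divide)

lemma weight_map_inner:
  assumes "\<tau> > 0" shows "weight_map \<tau> u \<bullet> weight_map (1/\<tau>) x = u \<bullet> x"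
  using assms by (simp add: weight_map_def real_sqrt_divide inner_prod_def)

lemma norm_triple_sq: "(norm (a, b, d))^2 = (norm a)^2 + (norm b)^2 + (norm d)^2"
  by (simp add: norm_Pair)

lemma norm_weight_map: "\<tau> > 0 \<Longrightarrow> norm (weight_map \<tau> z) = normM \<tau> z"
  by (cases z) (simp add: weight_map_def normM_def norm_Pair power_mult_distrib)

lemma norm_weight_map_le:
  assumes "\<tau> > 0" shows "norm (weight_map \<tau> z) \<le> sqrt (max 1 \<tau>) * norm z"
proof (cases z)
  case (fields a b d)
  have "\<tau> * (norm a)^2 + 1 * (norm b)^2 + 1 * (norm d)^2
     \<le> max 1 \<tau> * (norm a)^2 + max 1 \<tau> * (norm b)^2 + max 1 \<tau> * (norm d)^2"
    by (intro add_mono mult_right_mono) auto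
  then have "\<tau> * (norm a)^2 + (norm b)^2 + (norm d)^2 \<le> max 1 \<tau> * (norm z)^2"
    by (simp add: fields norm_triple_sq distrib_left)
  then have "normM \<tau> z \<le> sqrt (max 1 \<tau> * (norm z)^2)"
    by (simp add: fields normM_def)
  then show ?thesis using assms by (simp add: norm_weight_map real_sqrt_mult)
qed

text \<open>Transfers Euclidean estimates to the weighted distance. Nonemptiness matters:
  \<open>infdist\<close> to the empty set is 0 by convention, while \<open>distM\<close> is then an
  infimum over the empty set.\<close>

lemma distM_eq_infdist:
  assumes "\<tau> > 0" "C \<noteq> {}" shows "distM \<tau> x C = infdist (weight_map \<tau> x) (weight_map \<tau> ` C)"
  using assms by (simp add: distM_def infdist_def image_image dist_norm weight_map_diff[symmetric] norm_weight_map)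

lemma infdist_weight_map_le:
  assumes "\<tau> > 0" "closed C" "C \<noteq> {}"
  shows "infdist (weight_map \<tau> x) (weight_map \<tau> ` C) \<le> sqrt (max 1 \<tau>) * infdist x C"
proof -
  obtain q where q: "q \<in> C" "infdist x C = dist x q" using infdist_attains_inf[OF assms(2,3)] .
  have "infdist (weight_map \<tau> x) (weight_map \<tau> ` C) \<le> norm (weight_map \<tau> (x - q))"
    using infdist_le[of "weight_map \<tau> q" "weight_map \<tau> ` C" "weight_map \<tau> x"] q(1)
    by (simp add: dist_norm weight_map_diff)
  also have "\<dots> \<le> sqrt (max 1 \<tau>) * norm (x - q)" by (rule norm_weight_map_le[OF assms(1)])
  finally show ?thesis using q(2) by (simp add: dist_norm)
qed

section \<open>The KKT operator of the regression problem\<close>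

locale rank_group_lasso =
  fixes X :: "real^'p::finite^'n::finite" and y :: "real^'n" and lam :: real
    and G :: "'g::finite \<Rightarrow> 'p set" and wt :: "'g \<Rightarrow> real"
  assumes lam: "lam > 0" and wt_pos: "\<And>l. wt l > 0" and cover: "(\<Union>l. G l) = UNIV"
begin

sublocale L: sublinear "Lfun :: real^'n \<Rightarrow> real"
  by (rule sublinear_Lfun)

sublocale \<Psi>: sublinear "Psi G wt"
  by (rule sublinear_Psi[OF wt_pos])

abbreviation "T \<equiv> Top X y lam G wt"

text \<open>Dividing the last block by \<open>lam\<close> states the condition for
  \<open>Psi\<close> itself, in the form delivered by its proximal map.\<close>

lemma mem_Top_iff:
  "(a, b, d) \<in> T (w, s, \<beta>) \<longleftrightarrow>
     a = y + s - X *v \<beta> \<and> b + w \<in> subdiff Lfun s \<and> (1/lam) *\<^sub>R (d - transpose X *v w) \<in> subdiff (Psi G wt) \<beta>"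
proof -
  have "b \<in> (\<lambda>g. g - w) ` subdiff Lfun s \<longleftrightarrow> b + w \<in> subdiff Lfun s"
    by (auto simp: image_iff algebra_simps intro!: bexI[of _ "b + w"])
  moreover have "d \<in> (\<lambda>g. transpose X *v w + g) ` subdiff (\<lambda>b. lam * Psi G wt b) \<beta> \<longleftrightarrow>
      (1/lam) *\<^sub>R (d - transpose X *v w) \<in> subdiff (Psi G wt) \<beta>"
    unfolding subdiff_cmult[OF lam] image_image
  proof
    assume "(1/lam) *\<^sub>R (d - transpose X *v w) \<in> subdiff (Psi G wt) \<beta>"
    moreover have "d = transpose X *v w + lam *\<^sub>R ((1/lam) *\<^sub>R (d - transpose X *v w))" using lam by simp
    ultimately show "d \<in> (\<lambda>g. transpose X *v w + lam *\<^sub>R g) ` subdiff (Psi G wt) \<beta>" by (rule rev_image_eqI)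
  qed (use lam in auto)
  ultimately show ?thesis by (auto simp: Top_def)
qed

text \<open>For arbitrary \<open>v\<close> the optimality conditions of the two proximal steps are
  the last two inclusions. The first block is the gradient of the augmented Lagrangian at
  \<open>v\<close>, so inexact minimisation is felt only there.\<close>

lemma prox_step_mem_Top:
  assumes "\<sigma> > 0" and p: "p = prox \<sigma> Lfun (s + \<sigma> *\<^sub>R v)"
    and q: "q = prox (\<sigma> * lam) (Psi G wt) (\<beta> - \<sigma> *\<^sub>R (transpose X *v v))"
  shows "(y + p - X *v q, (1/\<sigma>) *\<^sub>R (s - p), (1/\<sigma>) *\<^sub>R (\<beta> - q)) \<in> T (v, p, q)"
proof -
  have "(1/\<sigma>) *\<^sub>R (s - p) + v = (1/\<sigma>) *\<^sub>R (s + \<sigma> *\<^sub>R v - p)"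
    using assms(1) by (simp add: scaleR_add_right scaleR_diff_right)
  moreover have "(1/lam) *\<^sub>R ((1/\<sigma>) *\<^sub>R (\<beta> - q) - transpose X *v v)
      = (1/(\<sigma> * lam)) *\<^sub>R (\<beta> - \<sigma> *\<^sub>R (transpose X *v v) - q)"
    using assms(1) lam by (simp add: scaleR_diff_right mult.commute)
  ultimately show ?thesis
    using L.prox_subgradient[OF assms(1)] \<Psi>.prox_subgradient[of "\<sigma> * lam"] assms(1) lam
    unfolding mem_Top_iff p q by simp
qed

text \<open>The coefficient \<open>t\<close> is \<open>\<tau>\<close> for the iteration and 1 for
  the resolvents of \<open>T\<close>. Each envelope is paired with its square, so that
  differentiation yields the proximal points.\<close>

lemma auglag_has_derivative:
  assumes "\<sigma> > 0"
  shows "((\<lambda>v. auglag X y lam G wt \<sigma> v s \<beta> + t / (2*\<sigma>) * (norm (v - v\<^sub>0))^2) has_derivative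
    (\<lambda>h. (y + prox \<sigma> Lfun (s + \<sigma> *\<^sub>R v) - X *v prox (\<sigma> * lam) (Psi G wt) (\<beta> - \<sigma> *\<^sub>R (transpose X *v v))
      + (t/\<sigma>) *\<^sub>R (v - v\<^sub>0)) \<bullet> h)) (at v)"
proof -
  let ?p = "prox \<sigma> Lfun (s + \<sigma> *\<^sub>R v)"
  let ?q = "prox (\<sigma> * lam) (Psi G wt) (\<beta> - \<sigma> *\<^sub>R (transpose X *v v))"
  have sl: "\<sigma> * lam > 0" using assms lam by simp
  have L: "((\<lambda>v. (norm (s + \<sigma> *\<^sub>R v))^2 / (2*\<sigma>) - moreau \<sigma> Lfun (s + \<sigma> *\<^sub>R v))
      has_derivative (\<lambda>h. ((1/\<sigma>) *\<^sub>R ?p) \<bullet> (\<sigma> *\<^sub>R h))) (at v)"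
    by (rule has_derivative_compose[OF _ L.has_derivative_sq_norm_minus_moreau[OF assms]])
      (auto intro!: derivative_eq_intros)
  have "((\<lambda>v. transpose X *v v) has_derivative (\<lambda>h. transpose X *v h)) (at v)"
    by (rule bounded_linear.has_derivative[OF matrix_vector_mul_bounded_linear has_derivative_ident])
  then have "((\<lambda>v. \<beta> - \<sigma> *\<^sub>R (transpose X *v v)) has_derivative (\<lambda>h. - (\<sigma> *\<^sub>R (transpose X *v h)))) (at v)"
    by (auto intro!: derivative_eq_intros)
  then have P: "((\<lambda>v. (norm (\<beta> - \<sigma> *\<^sub>R (transpose X *v v)))^2 / (2*(\<sigma> * lam))
        - moreau (\<sigma> * lam) (Psi G wt) (\<beta> - \<sigma> *\<^sub>R (transpose X *v v)))
      has_derivative (\<lambda>h. ((1/(\<sigma> * lam)) *\<^sub>R ?q) \<bullet> (- (\<sigma> *\<^sub>R (transpose X *v h))))) (at v)"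
    by (rule has_derivative_compose[OF _ \<Psi>.has_derivative_sq_norm_minus_moreau[OF sl]])
  have N: "((\<lambda>v. (v - v\<^sub>0) \<bullet> (v - v\<^sub>0)) has_derivative (\<lambda>h. (v - v\<^sub>0) \<bullet> h + h \<bullet> (v - v\<^sub>0))) (at v)"
    by (auto intro!: derivative_eq_intros)
  have Y: "((\<lambda>v. y \<bullet> v) has_derivative (\<lambda>h. y \<bullet> h)) (at v)"
    by (auto intro!: derivative_eq_intros)
  have "((\<lambda>v. y \<bullet> v + ((norm (s + \<sigma> *\<^sub>R v))^2 / (2*\<sigma>) - moreau \<sigma> Lfun (s + \<sigma> *\<^sub>R v))
      + lam * ((norm (\<beta> - \<sigma> *\<^sub>R (transpose X *v v)))^2 / (2*(\<sigma> * lam))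
          - moreau (\<sigma> * lam) (Psi G wt) (\<beta> - \<sigma> *\<^sub>R (transpose X *v v)))
      + t / (2*\<sigma>) * ((v - v\<^sub>0) \<bullet> (v - v\<^sub>0)) - ((norm s)^2 / (2*\<sigma>) + (norm \<beta>)^2 / (2*\<sigma>)))
    has_derivative (\<lambda>h. y \<bullet> h + ((1/\<sigma>) *\<^sub>R ?p) \<bullet> (\<sigma> *\<^sub>R h)
      + lam * (((1/(\<sigma> * lam)) *\<^sub>R ?q) \<bullet> (- (\<sigma> *\<^sub>R (transpose X *v h))))
      + t / (2*\<sigma>) * ((v - v\<^sub>0) \<bullet> h + h \<bullet> (v - v\<^sub>0)) - 0)) (at v)"
    by (intro has_derivative_add has_derivative_diff has_derivative_mult_right Y L P N has_derivative_const)
  moreover have "(\<lambda>h. y \<bullet> h + ((1/\<sigma>) *\<^sub>R ?p) \<bullet> (\<sigma> *\<^sub>R h)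
      + lam * (((1/(\<sigma> * lam)) *\<^sub>R ?q) \<bullet> (- (\<sigma> *\<^sub>R (transpose X *v h))))
      + t / (2*\<sigma>) * ((v - v\<^sub>0) \<bullet> h + h \<bullet> (v - v\<^sub>0)) - 0)
    = (\<lambda>h. (y + ?p - X *v ?q + (t/\<sigma>) *\<^sub>R (v - v\<^sub>0)) \<bullet> h)" (is "?l = ?r")
  proof
    fix h
    have "?q \<bullet> (transpose X *v h) = (X *v ?q) \<bullet> h"
      by (metis inner_commute inner_transpose_mult)
    moreover have "lam * (((1/(\<sigma> * lam)) *\<^sub>R ?q) \<bullet> (- (\<sigma> *\<^sub>R (transpose X *v h)))) = - (?q \<bullet> (transpose X *v h))"
      using assms lam by simp
    moreover have "t / (2*\<sigma>) * ((v - v\<^sub>0) \<bullet> h + h \<bullet> (v - v\<^sub>0)) = (t/\<sigma>) * ((v - v\<^sub>0) \<bullet> h)"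
      by (simp add: inner_commute)
    moreover have "((1/\<sigma>) *\<^sub>R ?p) \<bullet> (\<sigma> *\<^sub>R h) = ?p \<bullet> h" using assms by simp
    ultimately show "?l h = ?r h"
      by (simp only: inner_add_left inner_diff_left inner_scaleR_left)
  qed
  moreover have "(\<lambda>v. y \<bullet> v + ((norm (s + \<sigma> *\<^sub>R v))^2 / (2*\<sigma>) - moreau \<sigma> Lfun (s + \<sigma> *\<^sub>R v))
      + lam * ((norm (\<beta> - \<sigma> *\<^sub>R (transpose X *v v)))^2 / (2*(\<sigma> * lam))
          - moreau (\<sigma> * lam) (Psi G wt) (\<beta> - \<sigma> *\<^sub>R (transpose X *v v)))
      + t / (2*\<sigma>) * ((v - v\<^sub>0) \<bullet> (v - v\<^sub>0)) - ((norm s)^2 / (2*\<sigma>) + (norm \<beta>)^2 / (2*\<sigma>)))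
    = (\<lambda>v. auglag X y lam G wt \<sigma> v s \<beta> + t / (2*\<sigma>) * (norm (v - v\<^sub>0))^2)"
    using lam unfolding auglag_def power2_norm_eq_inner[of "_ - v\<^sub>0"]
    by (auto simp: right_diff_distrib)
  ultimately show ?thesis by simp
qed

text \<open>Each square dominates its envelope, by testing the envelope at 0. The remaining minorant
  is affine in \<open>v\<close>, so adding a proximal term gives coercivity.\<close>

lemma auglag_ge:
  assumes "\<sigma> > 0"
  shows "y \<bullet> v - (norm s)^2 / (2*\<sigma>) - (norm \<beta>)^2 / (2*\<sigma>) \<le> auglag X y lam G wt \<sigma> v s \<beta>"
proof -
  have "moreau (\<sigma> * lam) (Psi G wt) (\<beta> - \<sigma> *\<^sub>R (transpose X *v v))
      \<le> (norm (\<beta> - \<sigma> *\<^sub>R (transpose X *v v)))^2 / (2 * (\<sigma> * lam))"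
    using assms lam by (intro \<Psi>.moreau_le_norm) simp
  from mult_left_mono[OF this, of lam]
  have "lam * moreau (\<sigma> * lam) (Psi G wt) (\<beta> - \<sigma> *\<^sub>R (transpose X *v v))
      \<le> (norm (\<beta> - \<sigma> *\<^sub>R (transpose X *v v)))^2 / (2 * \<sigma>)" using lam by simp
  then show ?thesis
    using L.moreau_le_norm[OF assms, of "s + \<sigma> *\<^sub>R v"] by (simp add: auglag_def)
qed

text \<open>Minimising the augmented Lagrangian with a proximal term of weight 1 gives the
  resolvent: stationarity supplies the first block, the proximal steps the other two.\<close>

lemma resolvent_exists:
  assumes "c > 0" shows "\<exists>u. (1/c) *\<^sub>R (z - u) \<in> T u"
proof -
  obtain w s \<beta> where z: "z = (w, s, \<beta>)" by (cases z)
  let ?\<phi> = "\<lambda>v. auglag X y lam G wt c v s \<beta> + 1 / (2*c) * (norm (v - w))^2"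
  define A where "A = ?\<phi> w - y \<bullet> w + (norm s)^2 / (2*c) + (norm \<beta>)^2 / (2*c)"
  obtain v where v: "\<And>v'. ?\<phi> v \<le> ?\<phi> v'"
  proof (rule continuous_attains_global_min[of ?\<phi>])
    show "continuous_on UNIV ?\<phi>"
      using auglag_has_derivative[OF assms, of s \<beta> 1 w]
      by (intro continuous_at_imp_continuous_on ballI has_derivative_continuous)
    \<comment> \<open>Beyond this radius the quadratic term dominates \<open>norm y + |A|\<close>
      times the distance; the summand 1 makes the distance at least 1, so that the constant
      \<open>A\<close> is covered too.\<close>
    fix v assume big: "2 * c * (norm y + \<bar>A\<bar>) + 1 < norm (v - w)"
    let ?d = "norm (v - w)"
    have "\<bar>A\<bar> * 1 \<le> \<bar>A\<bar> * ?d"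
    proof (rule mult_left_mono)
      have "0 \<le> 2 * c * (norm y + \<bar>A\<bar>)" using assms by simp
      then show "1 \<le> ?d" using big by linarith
    qed simp
    moreover have "2 * c * (norm y + \<bar>A\<bar>) * ?d \<le> ?d * ?d"
      using big by (intro mult_right_mono) auto
    then have "(norm y + \<bar>A\<bar>) * ?d \<le> 1 / (2*c) * ?d^2"
      using assms by (simp add: field_simps power2_eq_square)
    moreover have "- (y \<bullet> (v - w)) \<le> norm y * ?d"
      using norm_cauchy_schwarz[of "- y" "v - w"] by simp
    ultimately have "A + y \<bullet> w \<le> y \<bullet> v + 1 / (2*c) * ?d^2"
      by (simp add: distrib_right inner_diff_right)
    then show "?\<phi> w \<le> ?\<phi> v" using auglag_ge[OF assms, of v s \<beta>] unfolding A_def by linarith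
  qed auto
  define p q where "p = prox c Lfun (s + c *\<^sub>R v)"
    and "q = prox (c * lam) (Psi G wt) (\<beta> - c *\<^sub>R (transpose X *v v))"
  have "(\<lambda>h. (y + p - X *v q + (1/c) *\<^sub>R (v - w)) \<bullet> h) = (\<lambda>h. 0)"
    by (rule has_derivative_local_min[OF auglag_has_derivative[OF assms, of s \<beta> 1 w v, folded p_def q_def]])
      (use v in auto)
  then have "y + p - X *v q + (1/c) *\<^sub>R (v - w) = 0"
    by (metis inner_eq_zero_iff)
  then have "y + p - X *v q = (1/c) *\<^sub>R (w - v)"
    by (simp add: scaleR_diff_right algebra_simps)
  then have "(1/c) *\<^sub>R (z - (v, p, q)) \<in> T (v, p, q)"
    using prox_step_mem_Top[OF assms p_def q_def] by (simp add: z)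
  then show ?thesis ..
qed

sublocale T: maximal_monotone_operator T
proof
  fix u x v x' assume "u \<in> T x" "v \<in> T x'"
  moreover obtain a b d w s \<beta> where 1: "u = (a, b, d)" "x = (w, s, \<beta>)" by (cases u, cases x)
  moreover obtain a' b' d' w' s' \<beta>' where 2: "v = (a', b', d')" "x' = (w', s', \<beta>')" by (cases v, cases x')
  ultimately have a: "a = y + s - X *v \<beta>" "a' = y + s' - X *v \<beta>'"
    and L: "0 \<le> ((b + w) - (b' + w')) \<bullet> (s - s')"
    and "0 \<le> ((1/lam) *\<^sub>R (d - transpose X *v w) - (1/lam) *\<^sub>R (d' - transpose X *v w')) \<bullet> (\<beta> - \<beta>')"
    by (auto simp: mem_Top_iff intro!: subdiff_monotone)
  then have "0 \<le> (1/lam) * (((d - transpose X *v w) - (d' - transpose X *v w')) \<bullet> (\<beta> - \<beta>'))"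
    by (simp add: scaleR_diff_right[symmetric])
  then have P: "0 \<le> ((d - transpose X *v w) - (d' - transpose X *v w')) \<bullet> (\<beta> - \<beta>')"
    using lam by (simp add: zero_le_divide_iff)
  \<comment> \<open>The linear terms in \<open>w\<close>, \<open>s\<close> and \<open>X\<close> are
    skew and cancel, which leaves the two subdifferential pairings.\<close>
  show "0 \<le> (u - v) \<bullet> (x - x')"
    using L P by (simp add: 1 2 a inner_simps inner_mult_transpose matrix_vector_mult_diff_distrib inner_commute)
next
  fix U x x' u' assume mem: "\<And>k::nat. U k \<in> T (x k)" and lim: "x \<longlonglongrightarrow> x'" "U \<longlonglongrightarrow> u'"
  let ?a = "\<lambda>z. fst z" and ?b = "\<lambda>z. fst (snd z)" and ?d = "\<lambda>z. snd (snd z)"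
  have iff: "u \<in> T z \<longleftrightarrow> ?a u = y + ?b z - X *v ?d z \<and> ?b u + ?a z \<in> subdiff Lfun (?b z) \<and>
      (1/lam) *\<^sub>R (?d u - transpose X *v ?a z) \<in> subdiff (Psi G wt) (?d z)" for u z
    using mem_Top_iff[of "?a u" "?b u" "?d u" "?a z" "?b z" "?d z"] by simp
  have mult: "(\<lambda>k. A *v f k) \<longlonglongrightarrow> A *v l" if "f \<longlonglongrightarrow> l" for A :: "real^'i^'j" and f l
    by (rule bounded_linear.tendsto[OF matrix_vector_mul_bounded_linear that])
  show "u' \<in> T x'"
    unfolding iff
  proof (intro conjI)
    have "(\<lambda>k. y + ?b (x k) - X *v ?d (x k)) \<longlonglongrightarrow> y + ?b x' - X *v ?d x'"
      by (intro tendsto_intros mult lim)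
    moreover have "(\<lambda>k. ?a (U k)) \<longlonglongrightarrow> ?a u'" by (intro tendsto_intros lim)
    moreover have "?a (U k) = y + ?b (x k) - X *v ?d (x k)" for k using mem iff by blast
    ultimately show "?a u' = y + ?b x' - X *v ?d x'" by (simp add: LIMSEQ_unique)
    show "?b u' + ?a x' \<in> subdiff Lfun (?b x')"
      by (rule subdiff_closed_graph[OF L.continuous, of "\<lambda>k. ?b (U k) + ?a (x k)" "\<lambda>k. ?b (x k)"])
        (use mem iff in blast, (intro tendsto_intros lim)+)
    show "(1/lam) *\<^sub>R (?d u' - transpose X *v ?a x') \<in> subdiff (Psi G wt) (?d x')"
      by (rule subdiff_closed_graph[OF \<Psi>.continuous, of "\<lambda>k. (1/lam) *\<^sub>R (?d (U k) - transpose X *v ?a (x k))" "\<lambda>k. ?d (x k)"])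
        (use mem iff in blast, (intro tendsto_intros mult lim)+)
  qed
qed (rule resolvent_exists)

lemma KKT_eq_zeros: "KKT X y lam G wt = T.zeros"
  by (simp add: KKT_def T.zeros_def)

text \<open>Resolvents \<open>(a, b, d)\<close> of 0 with \<open>c \<ge> 2\<close> are bounded:
  subgradients of \<open>Lfun\<close> are bounded, so \<open>a\<close> is bounded up to
  \<open>norm b / c\<close>; testing the inclusions against the blocks bounds \<open>Psi\<close> at
  \<open>d\<close>; the first block equation then bounds \<open>b\<close>.\<close>

lemma KKT_nonempty: "T.zeros \<noteq> {}"
proof -
  obtain K where K: "K \<ge> 0" "\<And>g x. g \<in> subdiff (Lfun :: real^'n \<Rightarrow> real) x \<Longrightarrow> norm g \<le> K"
    using L.subgradients_bounded by blast
  obtain C where C: "C \<ge> 0" "\<And>d. norm d \<le> C * Psi G wt d"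
    using norm_le_Psi[of wt G, OF wt_pos cover] by blast
  obtain N where N: "N > 0" "\<And>d. norm (X *v d) \<le> norm d * N"
    using bounded_linear.pos_bounded[OF matrix_vector_mul_bounded_linear[of X]] by blast
  define Bd where "Bd = C * ((K * norm y + (norm y)^2) / lam)"
  define Bt where "Bt = 2 * (Bd * N + norm y + K)"
  show ?thesis
  proof (rule T.zeros_nonempty_if_resolvents_bounded)
    fix c u assume c: "2 \<le> c" and u: "(1/c) *\<^sub>R (0 - u) \<in> T u"
    obtain a b d where abd: "u = (a, b, d)" by (cases u)
    define t where "t = norm b"
    have "(- ((1/c) *\<^sub>R a), - ((1/c) *\<^sub>R b), - ((1/c) *\<^sub>R d)) \<in> T (a, b, d)"
      using u by (simp add: abd scaleR_minus_right)
    then have a: "- ((1/c) *\<^sub>R a) = y + b - X *v d"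
      and g: "a - (1/c) *\<^sub>R b \<in> subdiff Lfun b"
      and h: "(1/lam) *\<^sub>R (- ((1/c) *\<^sub>R d) - transpose X *v a) \<in> subdiff (Psi G wt) d"
      unfolding mem_Top_iff by simp_all
    have "norm a \<le> norm (a - (1/c) *\<^sub>R b) + norm ((1/c) *\<^sub>R b)"
      using norm_triangle_ineq[of "a - (1/c) *\<^sub>R b" "(1/c) *\<^sub>R b"] by simp
    then have na: "norm a \<le> K + t / c"
      using K(2)[OF g] c by (simp add: t_def)
    \<comment> \<open>Pairing the inclusions with \<open>a\<close>, \<open>b\<close> and
      \<open>d\<close> and combining them cancels the skew terms; only the term with
      \<open>a \<bullet> y\<close> remains to be bounded.\<close>
    have "a \<bullet> (y + b - X *v d) = - ((norm a)^2 / c)"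
      unfolding a[symmetric] by (simp add: power2_norm_eq_inner)
    moreover have "a \<bullet> b - t^2 / c = Lfun b"
      using L.subgradient_inner[OF g] by (simp add: t_def inner_diff_left power2_norm_eq_inner)
    moreover have "(1/lam) * (- ((norm d)^2 / c) - a \<bullet> (X *v d)) = Psi G wt d"
      using \<Psi>.subgradient_inner[OF h]
      by (simp add: inner_diff_left power2_norm_eq_inner dot_lmul_matrix)
    then have "- ((norm d)^2 / c) - a \<bullet> (X *v d) = lam * Psi G wt d"
      using lam by (simp add: field_simps)
    moreover have "0 \<le> (norm a)^2 / c" "0 \<le> (norm d)^2 / c" using c by auto
    moreover have "0 \<le> Lfun b" by (rule L.nonneg)
    moreover have "- (a \<bullet> y) \<le> norm a * norm y"
      using norm_cauchy_schwarz[of "- a" y] by simp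
    moreover have "norm a * norm y \<le> (K + t / c) * norm y"
      using na by (rule mult_right_mono) simp
    ultimately have "lam * Psi G wt d + t^2 / c \<le> K * norm y + t * norm y / c"
      by (simp add: inner_add_right inner_diff_right distrib_right)
    \<comment> \<open>Young's inequality: \<open>t^2 / c\<close> is absorbed by the same term in the
      preceding estimate, and the remainder is independent of \<open>c\<close>.\<close>
    moreover have "t * norm y / c \<le> t^2 / c + (norm y)^2"
    proof -
      have "0 \<le> t * norm y" by (simp add: t_def)
      then have "t * norm y \<le> t^2 + (norm y)^2"
        using sum_squares_bound[of t "norm y"] unfolding mult.assoc by linarith
      then have "t * norm y / c \<le> (t^2 + (norm y)^2) / c" using c by (intro divide_right_mono) auto
      moreover have "(norm y)^2 / c \<le> (norm y)^2" using c by (simp add: divide_le_eq mult_le_cancel_left1)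
      ultimately show ?thesis by (simp add: add_divide_distrib)
    qed
    ultimately have "Psi G wt d \<le> (K * norm y + (norm y)^2) / lam"
      using lam by (simp add: field_simps)
    then have d: "norm d \<le> Bd"
      unfolding Bd_def using C(2)[of d] mult_left_mono[OF _ C(1)] by (meson order_trans)
    have "b = X *v d - y - (1/c) *\<^sub>R a" using a by (simp add: algebra_simps)
    then have "t \<le> norm (X *v d) + norm y + norm a / c"
      using norm_triangle_ineq4[of "X *v d - y" "(1/c) *\<^sub>R a"] norm_triangle_ineq4[of "X *v d" y] c
      by (simp add: t_def)
    also have "norm (X *v d) \<le> Bd * N"
      using N(2)[of d] mult_right_mono[OF d, of N] N(1) by linarith
    \<comment> \<open>Dividing by \<open>c \<ge> 2\<close> twice leaves the coefficient 1/4 on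
      \<open>t\<close>, which the left side absorbs.\<close>
    also have "norm a / c \<le> K + t / 4"
    proof -
      have "norm a / c \<le> (K + t / c) / c" using na c by (intro divide_right_mono) auto
      also have "\<dots> \<le> (K + t / 2) / 2"
        using c K(1) by (intro frac_le add_left_mono add_nonneg_nonneg) (auto simp: t_def)
      finally show ?thesis using K(1) by simp
    qed
    finally have "t \<le> Bt / 2 + t / 4" by (simp add: Bt_def del: distrib_left_numeral)
    then have t: "t \<le> Bt" using norm_ge_zero[of b, folded t_def] by linarith
    have "t / c \<le> t / 1" using c by (intro frac_le) (auto simp: t_def)
    then have "norm a \<le> K + Bt" using na t by simp
    moreover have "norm u \<le> norm a + (norm b + norm d)"
      unfolding abd using norm_Pair_le[of a "(b, d)"] norm_Pair_le[of b d] by linarith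
    ultimately show "norm u \<le> (K + Bt) + (Bt + Bd)" using t d by (simp add: t_def)
  qed
qed

text \<open>The subgradient inequalities at \<open>s\<close> and \<open>\<beta>\<close> are added;
  between feasible points \<open>X *v (\<beta>' - \<beta>) = s' - s\<close>, so the multiplier terms
  cancel.\<close>

lemma KKT_primal_opt:
  assumes "(w, s, \<beta>) \<in> T.zeros" shows "primal_opt X y lam G wt s \<beta>"
proof -
  have "(0, 0, 0) \<in> T (w, s, \<beta>)" using assms by (simp add: T.zeros_def zero_prod_def)
  then have eq: "0 = y + s - X *v \<beta>" and w: "w \<in> subdiff Lfun s"
    and g: "(1/lam) *\<^sub>R (- (transpose X *v w)) \<in> subdiff (Psi G wt) \<beta>"
    unfolding mem_Top_iff by simp_all
  have "Lfun s + lam * Psi G wt \<beta> \<le> Lfun s' + lam * Psi G wt \<beta>'" if f: "X *v \<beta>' - s' - y = 0" for s' \<beta>'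
  proof -
    have "Lfun s + w \<bullet> (s' - s) \<le> Lfun s'" using w unfolding subdiff_def by blast
    moreover have "Psi G wt \<beta> + ((1/lam) *\<^sub>R (- (transpose X *v w))) \<bullet> (\<beta>' - \<beta>) \<le> Psi G wt \<beta>'"
      using g unfolding subdiff_def by blast
    then have "lam * Psi G wt \<beta> - w \<bullet> (X *v (\<beta>' - \<beta>)) \<le> lam * Psi G wt \<beta>'"
      using lam by (simp add: dot_lmul_matrix field_simps)
    moreover have "X *v (\<beta>' - \<beta>) = s' - s"
      using eq f by (simp add: matrix_vector_mult_diff_distrib algebra_simps)
    ultimately show ?thesis by simp
  qed
  moreover have "X *v \<beta> - s - y = 0" using eq by (simp add: algebra_simps)
  ultimately show ?thesis unfolding primal_opt_def by blast
qed

lemma KKT_dual_opt: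
  assumes "(w, s, \<beta>) \<in> T.zeros" shows "dual_opt X y lam G wt w"
proof -
  have "(0, 0, 0) \<in> T (w, s, \<beta>)" using assms by (simp add: T.zeros_def zero_prod_def)
  then have eq: "0 = y + s - X *v \<beta>" and w: "w \<in> subdiff Lfun s"
    and g: "- (1/lam) *\<^sub>R (transpose X *v w) \<in> subdiff (Psi G wt) \<beta>"
    unfolding mem_Top_iff by simp_all
  \<comment> \<open>The variable \<open>v\<close> enters only through its product with the zero
    residual \<open>y + s - X *v \<beta>\<close>. Fenchel-Young at \<open>s\<close> and
    \<open>\<beta>\<close> thus bounds every dual value below by the negative primal value, with
    equality at \<open>w\<close>.\<close>
  have val: "y \<bullet> v + (v \<bullet> s - Lfun s) + lam * ((- (1/lam) *\<^sub>R (transpose X *v v)) \<bullet> \<beta> - Psi G wt \<beta>)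
      = - Lfun s - lam * Psi G wt \<beta>" for v
  proof -
    have "v \<bullet> (y + s - X *v \<beta>) = 0" using eq by simp
    then show ?thesis using lam
      by (simp add: inner_simps inner_mult_transpose right_diff_distrib inner_commute)
  qed
  have "dual_obj X y lam G wt w = ereal (- Lfun s - lam * Psi G wt \<beta>)"
    unfolding dual_obj_def conjugate_subgradient[OF w] conjugate_subgradient[OF g] val[of w, symmetric] by simp
  moreover have "ereal (- Lfun s - lam * Psi G wt \<beta>) \<le> dual_obj X y lam G wt v" for v
  proof -
    have "ereal (- Lfun s - lam * Psi G wt \<beta>) = ereal (y \<bullet> v) + ereal (v \<bullet> s - Lfun s)
        + ereal lam * ereal ((- (1/lam) *\<^sub>R (transpose X *v v)) \<bullet> \<beta> - Psi G wt \<beta>)"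
      unfolding val[of v, symmetric] by simp
    also have "\<dots> \<le> dual_obj X y lam G wt v"
      unfolding dual_obj_def using lam by (intro add_mono ereal_mult_left_mono conjugate_ge) auto
    finally show ?thesis .
  qed
  ultimately show ?thesis unfolding dual_opt_def by simp
qed

end

section \<open>Convergence and linear rate of the inexact augmented Lagrangian method\<close>

theorem theorem2:
  fixes X :: "real^'p::finite^'n::finite" and y :: "real^'n" and lam :: real
    and G :: "'g::finite \<Rightarrow> 'p set" and wt :: "'g \<Rightarrow> real"
    and w s :: "nat \<Rightarrow> real^'n" and \<beta> :: "nat \<Rightarrow> real^'p"
    and \<sigma> \<delta> :: "nat \<Rightarrow> real" and \<tau> :: real
  assumes n2: "CARD('n) \<ge> 2"
    and lam: "lam > 0"
    and G_ne: "\<forall>l. G l \<noteq> {}"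
    and G_disj: "\<forall>l l'. l \<noteq> l' \<longrightarrow> G l \<inter> G l' = {}"
    and G_cover: "(\<Union>l. G l) = UNIV"
    and wt_pos: "\<forall>l. wt l > 0"
    and sigma0: "\<sigma> 0 > 0"
    and tau: "\<tau> > 0"
    and delta: "\<forall>k. 0 < \<delta> k \<and> \<delta> k < 1"
    and delta_sum: "summable \<delta>"
    and s_upd: "\<forall>k. s (Suc k) = \<sigma> k *\<^sub>R prox 1 Lfun ((1 / \<sigma> k) *\<^sub>R s k + w (Suc k))"
    and beta_upd: "\<forall>k. \<beta> (Suc k) = (\<sigma> k * lam) *\<^sub>R prox 1 (Psi G wt)
                      ((1 / (\<sigma> k * lam)) *\<^sub>R \<beta> k - (1 / lam) *\<^sub>R (transpose X *v w (Suc k)))"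
    and inexact: "\<forall>k. norm (grad (\<lambda>v. auglag X y lam G wt (\<sigma> k) v (s k) (\<beta> k)
                                 + \<tau> / (2 * \<sigma> k) * (norm (v - w k))^2) (w (Suc k)))
            \<le> \<delta> k * min 1 (sqrt \<tau>) / \<sigma> k *
              min 1 (sqrt (\<tau> * (norm (w (Suc k) - w k))^2 + (norm (s (Suc k) - s k))^2
                           + (norm (\<beta> (Suc k) - \<beta> k))^2))"
    and sigma_mono: "\<forall>k. \<sigma> k \<le> \<sigma> (Suc k)"
  shows "(\<exists>s_opt \<beta>_opt w_opt. s \<longlonglongrightarrow> s_opt \<and> \<beta> \<longlonglongrightarrow> \<beta>_opt \<and> w \<longlonglongrightarrow> w_opt \<and>
            primal_opt X y lam G wt s_opt \<beta>_opt \<and> dual_opt X y lam G wt w_opt)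
       \<and> (\<forall>r \<kappa>. r > (\<Sum>k. \<delta> k) \<longrightarrow> \<kappa> > 0 \<longrightarrow>
            (\<forall>z. infdist z (KKT X y lam G wt) \<le> r \<longrightarrow>
                 infdist z (KKT X y lam G wt) \<le> \<kappa> * infdist 0 (Top X y lam G wt z)) \<longrightarrow>
            infdist (w 0, s 0, \<beta> 0) (KKT X y lam G wt) \<le> r - (\<Sum>k. \<delta> k) \<longrightarrow>
            (\<forall>k. distM \<tau> (w (Suc k), s (Suc k), \<beta> (Suc k)) (KKT X y lam G wt)
                 \<le> (1 / (1 - \<delta> k)) * (\<delta> k + (1 + \<delta> k) * \<kappa> * max 1 \<tau>
                      / sqrt ((\<sigma> k)^2 + \<kappa>^2 * (max 1 \<tau>)^2))
                   * distM \<tau> (w k, s k, \<beta> k) (KKT X y lam G wt)))"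
proof -
  interpret rank_group_lasso X y lam G wt
    by unfold_locales (use lam wt_pos G_cover in auto)
  define Z where "Z k = (w k, s k, \<beta> k)" for k
  define x where "x k = weight_map \<tau> (Z k)" for k
  define g where "g k = grad (\<lambda>v. auglag X y lam G wt (\<sigma> k) v (s k) (\<beta> k)
      + \<tau> / (2 * \<sigma> k) * (norm (v - w k))^2) (w (Suc k))" for k
  \<comment> \<open>The factor is chosen so that \<open>weight_map \<tau>\<close> applied to
    \<open>e k / \<sigma> k\<close> gives \<open>(g k, 0, 0)\<close>.\<close>
  define e :: "nat \<Rightarrow> (real^'n) \<times> (real^'n) \<times> (real^'p)" where "e k = ((\<sigma> k / sqrt \<tau>) *\<^sub>R g k, 0, 0)" for k
  have \<sigma>_ge: "\<sigma> 0 \<le> \<sigma> k" for k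
    using sigma_mono by (induction k) (auto intro: order_trans)
  then have \<sigma>_pos: "\<sigma> k > 0" for k using sigma0 less_le_trans by blast
  have inv: "weight_map (1/\<tau>) (x k) = Z k" for k
    unfolding x_def by (rule weight_map_inverse[OF tau])
  \<comment> \<open>In scaled coordinates the method is a proximal point iteration for
    \<open>M^(-1/2) T M^(-1/2)\<close>.\<close>
  interpret W: closed_monotone_operator "\<lambda>x. {u. weight_map \<tau> u \<in> T (weight_map (1/\<tau>) x)}"
    by (intro T.change_of_variables bounded_linear_weight_map weight_map_inner tau)
  have W_zeros: "W.zeros = weight_map \<tau> ` T.zeros"
  proof -
    have iff: "z \<in> W.zeros \<longleftrightarrow> weight_map (1/\<tau>) z \<in> T.zeros" for z
      by (simp add: W.zeros_def T.zeros_def weight_map_zero)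
    show ?thesis
    proof (intro set_eqI iffI)
      fix z assume "z \<in> W.zeros"
      then have "weight_map (1/\<tau>) z \<in> T.zeros" by (simp only: iff)
      from imageI[OF this, of "weight_map \<tau>"] show "z \<in> weight_map \<tau> ` T.zeros"
        by (simp only: weight_map_inverse[OF tau])
    next
      fix z assume "z \<in> weight_map \<tau> ` T.zeros"
      then show "z \<in> W.zeros" by (auto simp only: iff weight_map_inverse[OF tau])
    qed
  qed
  have W_ne: "W.zeros \<noteq> {}" using KKT_nonempty by (simp add: W_zeros)

  have s_eq: "s (Suc k) = prox (\<sigma> k) Lfun (s k + \<sigma> k *\<^sub>R w (Suc k))" for k
    using s_upd[rule_format, of k] L.scaled_prox[OF \<sigma>_pos, of k "s k + \<sigma> k *\<^sub>R w (Suc k)"] \<sigma>_pos[of k]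
    by (simp add: scaleR_add_right)
  have \<beta>_eq: "\<beta> (Suc k) = prox (\<sigma> k * lam) (Psi G wt) (\<beta> k - \<sigma> k *\<^sub>R (transpose X *v w (Suc k)))" for k
    using beta_upd[rule_format, of k]
      \<Psi>.scaled_prox[of "\<sigma> k * lam" "\<beta> k - \<sigma> k *\<^sub>R (transpose X *v w (Suc k))"] \<sigma>_pos[of k] lam
    by (simp add: scaleR_diff_right)
  have g_eq: "g k = y + s (Suc k) - X *v \<beta> (Suc k) + (\<tau> / \<sigma> k) *\<^sub>R (w (Suc k) - w k)" for k
    unfolding g_def s_eq \<beta>_eq by (rule grad_eqI[OF auglag_has_derivative[OF \<sigma>_pos]])
  \<comment> \<open>The proximal term in \<open>g k\<close> cancels the displacement of
    \<open>w\<close>, so the first block is the pure feasibility residual.\<close>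
  have val: "weight_map \<tau> ((1 / \<sigma> k) *\<^sub>R (x k + e k - x (Suc k))) \<in> T (Z (Suc k))" for k
  proof -
    have "sqrt \<tau> *\<^sub>R (1 / \<sigma> k) *\<^sub>R (sqrt \<tau> *\<^sub>R w k + (\<sigma> k / sqrt \<tau>) *\<^sub>R g k - sqrt \<tau> *\<^sub>R w (Suc k))
        = ((sqrt \<tau> * sqrt \<tau>) / \<sigma> k) *\<^sub>R (w k - w (Suc k)) + g k"
      using \<sigma>_pos[of k] tau by (simp add: scaleR_add_right scaleR_diff_right del: real_sqrt_mult_self)
    also have "\<dots> = y + s (Suc k) - X *v \<beta> (Suc k)"
      using tau unfolding g_eq by (simp add: algebra_simps)
    finally show ?thesis
      using prox_step_mem_Top[OF \<sigma>_pos s_eq \<beta>_eq, of k]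
      by (simp add: weight_map_def x_def Z_def e_def)
  qed
  then have step: "(1 / \<sigma> k) *\<^sub>R (x k + e k - x (Suc k)) \<in> {u. weight_map \<tau> u \<in> T (weight_map (1/\<tau>) (x (Suc k)))}" for k
    by (simp add: inv)
  have err: "norm (e k) \<le> \<delta> k * min 1 (norm (x (Suc k) - x k))" for k
  proof -
    let ?m = "min 1 (norm (x (Suc k) - x k))"
    have "norm (x (Suc k) - x k) = sqrt (\<tau> * (norm (w (Suc k) - w k))^2 + (norm (s (Suc k) - s k))^2
        + (norm (\<beta> (Suc k) - \<beta> k))^2)"
      unfolding x_def weight_map_diff[symmetric] norm_weight_map[OF tau] by (simp add: Z_def normM_def)
    then have "norm (g k) \<le> \<delta> k * min 1 (sqrt \<tau>) / \<sigma> k * ?m"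
      using inexact[rule_format, of k, folded g_def] by simp
    then have "\<sigma> k * norm (g k) \<le> \<delta> k * min 1 (sqrt \<tau>) * ?m"
      using \<sigma>_pos[of k] by (simp add: field_simps)
    \<comment> \<open>The factor \<open>min 1 (sqrt \<tau>)\<close> of the inexactness criterion
      compensates the \<open>1 / sqrt \<tau>\<close> in \<open>e k\<close>.\<close>
    also have "\<dots> \<le> \<delta> k * sqrt \<tau> * ?m"
      using delta by (intro mult_right_mono mult_left_mono) (auto simp: less_imp_le)
    finally have "\<sigma> k * norm (g k) / sqrt \<tau> \<le> \<delta> k * ?m"
      using tau by (simp add: field_simps)
    moreover have "norm (e k) = \<sigma> k * norm (g k) / sqrt \<tau>"
      unfolding e_def norm_Pair using tau \<sigma>_pos[of k] by (simp del: norm_scaleR) simp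
    ultimately show ?thesis by simp
  qed
  \<comment> \<open>The summable bound serves convergence and the growth of the distance to the
    zeros, the relative bound serves the rate.\<close>
  have err1: "norm (e k) \<le> \<delta> k" and err2: "norm (e k) \<le> \<delta> k * norm (x (Suc k) - x k)" for k
    using order_trans[OF err[of k] mult_left_mono] delta[rule_format, of k]
    by (metis less_imp_le min.cobounded1 mult.right_neutral, metis less_imp_le min.cobounded2)

  have convergence: "\<exists>s_opt \<beta>_opt w_opt. s \<longlonglongrightarrow> s_opt \<and> \<beta> \<longlonglongrightarrow> \<beta>_opt \<and> w \<longlonglongrightarrow> w_opt \<and>
      primal_opt X y lam G wt s_opt \<beta>_opt \<and> dual_opt X y lam G wt w_opt"
  proof -
    obtain l where l: "l \<in> W.zeros" "x \<longlonglongrightarrow> l"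
      using W.inexact_proximal_point_converges[OF W_ne sigma0 \<sigma>_ge step err1 delta_sum] .
    then obtain w' s' \<beta>' where l': "l = weight_map \<tau> (w', s', \<beta>')" "(w', s', \<beta>') \<in> T.zeros"
      by (auto simp: W_zeros)
    have "(\<lambda>k. weight_map (1/\<tau>) (x k)) \<longlonglongrightarrow> weight_map (1/\<tau>) l"
      by (rule bounded_linear.tendsto[OF bounded_linear_weight_map l(2)])
    then have Z: "Z \<longlonglongrightarrow> (w', s', \<beta>')"
      unfolding inv l'(1) weight_map_inverse[OF tau] .
    have "w \<longlonglongrightarrow> w'" "s \<longlonglongrightarrow> s'" "\<beta> \<longlonglongrightarrow> \<beta>'"
      using tendsto_fst[OF Z] tendsto_fst[OF tendsto_snd[OF Z]] tendsto_snd[OF tendsto_snd[OF Z]]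
      by (simp_all add: Z_def)
    then show ?thesis using KKT_primal_opt[OF l'(2)] KKT_dual_opt[OF l'(2)] by blast
  qed

  have rate: "distM \<tau> (Z (Suc k)) T.zeros
      \<le> (1 / (1 - \<delta> k)) * (\<delta> k + (1 + \<delta> k) * \<kappa> * max 1 \<tau> / sqrt ((\<sigma> k)^2 + \<kappa>^2 * (max 1 \<tau>)^2))
        * distM \<tau> (Z k) T.zeros"
    if r: "r > suminf \<delta>" and \<kappa>: "\<kappa> > 0"
      and eb: "\<And>z. infdist z T.zeros \<le> r \<Longrightarrow> infdist z T.zeros \<le> \<kappa> * infdist 0 (T z)"
      and start: "infdist (Z 0) T.zeros \<le> r - suminf \<delta>" for r \<kappa> k
  proof -
    define \<gamma> where "\<gamma> = max 1 \<tau>"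
    have \<gamma>: "1 \<le> sqrt \<gamma>" "sqrt \<gamma> * sqrt \<gamma> = \<gamma>" "\<gamma> > 0" by (auto simp: \<gamma>_def)
    have partial: "sum \<delta> {..<k} \<le> suminf \<delta>" for k
      using delta by (intro sum_le_suminf delta_sum) (auto simp: less_imp_le)
    have "0 \<le> suminf \<delta>" using partial[of 0] by simp
    then have "r > 0" using r by simp
    have W_le: "infdist (x k) W.zeros \<le> sqrt \<gamma> * infdist (Z k) T.zeros" for k
      unfolding x_def W_zeros \<gamma>_def by (intro infdist_weight_map_le tau T.closed_zeros KKT_nonempty)
    have growth: "infdist (x k) W.zeros \<le> infdist (x 0) W.zeros + sum \<delta> {..<k}" for k
    proof (induction k)
      case (Suc k)
      have "infdist (x (Suc k)) W.zeros \<le> infdist (x k + e k) W.zeros"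
        by (rule W.infdist_resolvent(2)[OF W_ne \<sigma>_pos step])
      then show ?case using Suc W.infdist_perturb[of "x k" "e k"] err1[of k] by simp
    qed simp
    have "infdist (x 0) W.zeros \<le> sqrt \<gamma> * (r - suminf \<delta>)"
      using W_le[of 0] mult_left_mono[OF start, of "sqrt \<gamma>"] \<gamma>(1) by linarith
    \<comment> \<open>Since \<open>sqrt \<gamma> \<ge> 1\<close>, the accumulated errors fit into
      the scaled margin left by the starting condition.\<close>
    moreover have "suminf \<delta> \<le> sqrt \<gamma> * suminf \<delta>"
      using mult_right_mono[OF \<gamma>(1) \<open>0 \<le> suminf \<delta>\<close>] by simp
    ultimately have "infdist (x k) W.zeros \<le> sqrt \<gamma> * r" for k
      using growth[of k] partial[of k] unfolding right_diff_distrib by linarith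
    \<comment> \<open>The iterates may leave the tube of radius \<open>r\<close>, but their weighted distance to the zeros stays
      below \<open>sqrt \<gamma> * r\<close>, which is what the truncated error bound yields there.\<close>
    then have "infdist (x (Suc k)) W.zeros \<le> sqrt \<gamma> * min (infdist (Z (Suc k)) T.zeros) r"
      using W_le[of "Suc k"] by (simp add: min_def)
    also have "\<dots> \<le> sqrt \<gamma> * (\<kappa> * norm (weight_map \<tau> ((1 / \<sigma> k) *\<^sub>R (x k + e k - x (Suc k)))))"
      using T.truncated_error_bound[OF KKT_nonempty \<open>r > 0\<close> \<kappa> val eb, of k] \<gamma>
      by (intro mult_left_mono) auto
    also have "\<dots> \<le> sqrt \<gamma> * (\<kappa> * (sqrt \<gamma> * norm ((1 / \<sigma> k) *\<^sub>R (x k + e k - x (Suc k)))))"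
      unfolding \<gamma>_def using \<kappa> tau by (intro mult_left_mono norm_weight_map_le) auto
    \<comment> \<open>One factor \<open>sqrt \<gamma>\<close> comes from comparing distances and one
      from comparing residuals; together they give the modulus \<open>\<kappa> * \<gamma>\<close> of
      the rate.\<close>
    also have "\<dots> = \<kappa> * \<gamma> * norm ((1 / \<sigma> k) *\<^sub>R (x k + e k - x (Suc k)))"
      using arg_cong[OF \<gamma>(2), of "\<lambda>c. \<kappa> * c * norm ((1 / \<sigma> k) *\<^sub>R (x k + e k - x (Suc k)))"]
      by (simp only: mult_ac)
    finally have "infdist (x (Suc k)) W.zeros \<le> (1 / (1 - \<delta> k)) *
        (\<delta> k + (1 + \<delta> k) * (\<kappa> * \<gamma> / sqrt ((\<sigma> k)^2 + (\<kappa> * \<gamma>)^2))) * infdist (x k) W.zeros"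
      using delta \<kappa> \<gamma>(3)
      by (intro W.inexact_proximal_point_rate[OF W_ne \<sigma>_pos _ _ _ step err2]) (auto simp: less_imp_le)
    then show ?thesis
      unfolding distM_eq_infdist[OF tau KKT_nonempty] W_zeros x_def \<gamma>_def
      by (simp add: power_mult_distrib mult.assoc)
  qed
  show ?thesis
    using convergence rate unfolding KKT_eq_zeros Z_def by blast
qed

end
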